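(* Let $K$ be a commutative ring, $\delta\in K$, $r\ge1$, and for $1\le j\le r$ put $\Theta_j=\Theta_j(r)=\sum_{0\le a<j}\mathbb H_{aj}(r)\in AB_r(\delta)$. Then the following hold for all valid indices: (a) $\iota(e_1)\Theta_1^\ell\iota(e_1)=(Z_\ell\otimes I_r)\iota(e_1)$ for $\ell\ge1$; (b) $\Theta_i\Theta_j=\Theta_j\Theta_i$ for all $i,j$; (c) $\iota(s_k)\Theta_j=\Theta_j\iota(s_k)$ and $\iota(e_k)\Theta_j=\Theta_j\iota(e_k)$ if $j\notin\{k,k+1\}$; (d) $\iota(s_k)\Theta_k-\Theta_{k+1}\iota(s_k)=\iota(e_k)-\mathbb I_r$ and $\Theta_k\iota(s_k)-\iota(s_k)\Theta_{k+1}=\iota(e_k)-\mathbb I_r$; (e) $\iota(e_k)(\Theta_k+\Theta_{k+1})=(1-\delta)\iota(e_k)$ and $(\Theta_k+\Theta_{k+1})\iota(e_k)=(1-\delta)\iota(e_k)$.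
   Context: Let $\mathcal B(\delta)$ be the Brauer category over $K$ (objects $\mathbb N$, morphisms spanned by Brauer diagrams, composition by stacking with closed loops replaced by $\delta$, $\otimes$ juxtaposition), with identity $I$, crossing $X$, cap $\cap:2\to0$, cup $\cup:0\to2$, $I_r=I^{\otimes r}$, $H=X-\cup\circ\cap$. The polar Brauer category $\mathcal{AB}(\delta)$ is the $K$-linear category with objects $\mathbb N$ generated, under composition and the right action $\mathbb D\mapsto\mathbb D\otimes B$ of Brauer morphisms $B$ (juxtaposed on the right), by $\mathbb I_0$ (a vertical pole, identity of $0$) and $\mathbb H:1\to1$ (pole joined by a horizontal connector to one thin strand), subject to: $(\mathbb I_0\otimes B)(\mathbb I_0\otimes A)=\mathbb I_0\otimes BA$, $(\mathbb H\otimes B)(\mathbb I_1\otimes A)=(\mathbb I_1\otimes B)(\mathbb H\otimes A)=\mathbb H\otimes BA$ ($\mathbb I_r=\mathbb I_0\otimes I_r$); the four-term relation $[\mathbb H\otimes I,\mathbb X_0(\mathbb H\otimes I)\mathbb X_0+\mathbb I_0\otimes H]=0$ with $\mathbb X_0=\mathbb I_0\otimes X$; and skew symmetry $(\mathbb I_0\otimes\cap\otimes I)(\mathbb H\otimes X)(\mathbb I_0\otimes\cup\otimes I)=-\mathbb H$; all imposed in every composite and right tensor product. Products denote composition. $Z_\ell=(\mathbb I_0\otimes\cap)(\mathbb H^\ell\otimes I)(\mathbb I_0\otimes\cup)\in\mathrm{End}(0)$. In $\mathrm{End}_{\mathcal{AB}(\delta)}(r)$: for $1\le i\le r$, let $\sigma$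 be the permutation Brauer diagram moving strand $i$ to position $1$ and strands $1,\dots,i-1$ to positions $2,\dots,i$, and $\mathbb H_{0i}(r)=(\mathbb I_0\otimes\sigma^{-1})(\mathbb H\otimes I_{r-1})(\mathbb I_0\otimes\sigma)$. For $1\le i<j\le r$, $\mathbb H_{ij}(r)=\mathbb I_0\otimes H_{ij}$ where $H_{ij}=(i\,j)-e_{ij}$, $(i\,j)$ the transposition diagram and $e_{ij}$ the diagram joining bottom $i$ to bottom $j$ and top $i$ to top $j$. $s_k=(k\,k+1)$, $e_k=e_{k,k+1}$, $\iota(x)=\mathbb I_0\otimes x$, and $AB_r(\delta)$ is the subalgebra of $\mathrm{End}(r)$ generated by the $\mathbb H_{0j}(r)$, $\iota(s_k)$, $\iota(e_k)$. *)

theory Defs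
  imports Main
begin

text \<open>Points of a Brauer diagram n -> m: bottom points Bt i (i < n) and top points
 Tp j (j < m), 0-indexed (position p in the paper is index p-1).  A diagram is a triple
 (n, m, f) where f is a fixed-point-free involution of the point set, identity elsewhere.\<close>

datatype pt = Bt nat | Tp nat

type_synonym diag = "nat \<times> nat \<times> (pt \<Rightarrow> pt)"

definition ddom :: "diag \<Rightarrow> nat" where "ddom D = fst D"
definition dcod :: "diag \<Rightarrow> nat" where "dcod D = fst (snd D)"
definition dmap :: "diag \<Rightarrow> pt \<Rightarrow> pt" where "dmap D = snd (snd D)"

definition pts :: "nat \<Rightarrow> nat \<Rightarrow> pt set" where
  "pts n m = Bt ` {..<n} \<union> Tp ` {..<m}"

definition valid_diag :: "diag \<Rightarrow> bool" where
  "valid_diag D \<longleftrightarrow>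
     (\<forall>x\<in>pts (ddom D) (dcod D). dmap D x \<in> pts (ddom D) (dcod D) \<and> dmap D x \<noteq> x
                                  \<and> dmap D (dmap D x) = x) \<and>
     (\<forall>x. x \<notin> pts (ddom D) (dcod D) \<longrightarrow> dmap D x = x)"

definition shf :: "diag \<Rightarrow> pt \<Rightarrow> pt" where
  "shf A p = (case p of Bt i \<Rightarrow> Bt (i + ddom A) | Tp k \<Rightarrow> Tp (k + dcod A))"

definition dtens :: "diag \<Rightarrow> diag \<Rightarrow> diag" where
  "dtens A B = (ddom A + ddom B, dcod A + dcod B,
     (\<lambda>p. case p of
        Bt i \<Rightarrow> if i < ddom A then dmap A (Bt i) else shf A (dmap B (Bt (i - ddom A)))
      | Tp k \<Rightarrow> if k < dcod A then dmap A (Tp k) else shf A (dmap B (Tp (k - dcod A)))))"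

text \<open>Stacking: B after A (A : n -> m below, B : m -> p on top).  Vertices of the stacked
 picture: L i (bottom of A), M j (middle row), U k (top of B).\<close>

datatype cv = L nat | M nat | U nat

definition embA :: "pt \<Rightarrow> cv" where
  "embA p = (case p of Bt i \<Rightarrow> L i | Tp j \<Rightarrow> M j)"
definition embB :: "pt \<Rightarrow> cv" where
  "embB p = (case p of Bt j \<Rightarrow> M j | Tp k \<Rightarrow> U k)"

definition cedge :: "diag \<Rightarrow> diag \<Rightarrow> cv \<Rightarrow> cv \<Rightarrow> bool" where
  "cedge A B x y \<longleftrightarrow>
     (\<exists>a\<in>pts (ddom A) (dcod A). x = embA a \<and> y = embA (dmap A a)) \<or>
     (\<exists>b\<in>pts (ddom B) (dcod B). x = embB b \<and> y = embB (dmap B b))"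

definition cconn :: "diag \<Rightarrow> diag \<Rightarrow> cv \<Rightarrow> cv \<Rightarrow> bool" where
  "cconn A B = (cedge A B)\<^sup>*\<^sup>*"

definition cends :: "diag \<Rightarrow> diag \<Rightarrow> cv set" where
  "cends A B = L ` {..<ddom A} \<union> U ` {..<dcod B}"

definition cvpt :: "cv \<Rightarrow> pt" where
  "cvpt v = (case v of L i \<Rightarrow> Bt i | U k \<Rightarrow> Tp k | M j \<Rightarrow> Bt 0)"

definition partner :: "diag \<Rightarrow> diag \<Rightarrow> cv \<Rightarrow> pt" where
  "partner A B x = cvpt (THE y. y \<in> cends A B \<and> y \<noteq> x \<and> cconn A B x y)"

text \<open>The diagram B\<cdot>A obtained by stacking (closed loops removed) and the number of
 closed loops; in the Brauer category B \<circ> A = \<delta>^(loops B A) \<cdot> (dcomp B A).\<close>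

definition dcomp :: "diag \<Rightarrow> diag \<Rightarrow> diag" where
  "dcomp B A = (ddom A, dcod B,
     (\<lambda>p. case p of
        Bt i \<Rightarrow> if i < ddom A then partner A B (L i) else Bt i
      | Tp k \<Rightarrow> if k < dcod B then partner A B (U k) else Tp k))"

definition loops :: "diag \<Rightarrow> diag \<Rightarrow> nat" where
  "loops B A = card {C. \<exists>j<dcod A. C = Collect (cconn A B (M j)) \<and> C \<inter> cends A B = {}}"

definition idd :: "nat \<Rightarrow> diag" where
  "idd n = (n, n, (\<lambda>p. case p of Bt i \<Rightarrow> if i < n then Tp i else Bt i
                               | Tp j \<Rightarrow> if j < n then Bt j else Tp j))"

definition permd :: "nat \<Rightarrow> (nat \<Rightarrow> nat) \<Rightarrow> diag" where
  "permd n \<pi> = (n, n, (\<lambda>p. case p of Bt i \<Rightarrow> if i < n then Tp (\<pi> i) else Bt i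
                                 | Tp j \<Rightarrow> if j < n then Bt (inv_into {..<n} \<pi> j) else Tp j))"

definition tr :: "nat \<Rightarrow> nat \<Rightarrow> nat \<Rightarrow> nat" where
  "tr a b x = (if x = a then b else if x = b then a else x)"

definition crossX :: diag where "crossX = permd 2 (tr 0 1)"

definition capd :: diag where
  "capd = (2, 0, (\<lambda>p. if p = Bt 0 then Bt 1 else if p = Bt 1 then Bt 0 else p))"

definition cupd :: diag where
  "cupd = (0, 2, (\<lambda>p. if p = Tp 0 then Tp 1 else if p = Tp 1 then Tp 0 else p))"

text \<open>Transposition diagram (i j) and e_ij on r strands; i, j are 1-indexed positions.\<close>

definition transpd :: "nat \<Rightarrow> nat \<Rightarrow> nat \<Rightarrow> diag" where
  "transpd r i j = permd r (tr (i - 1) (j - 1))"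

definition eijd :: "nat \<Rightarrow> nat \<Rightarrow> nat \<Rightarrow> diag" where
  "eijd r i j = (r, r, (\<lambda>p. case p of
        Bt a \<Rightarrow> if a = i - 1 then Bt (j - 1) else if a = j - 1 then Bt (i - 1)
                else if a < r then Tp a else Bt a
      | Tp a \<Rightarrow> if a = i - 1 then Tp (j - 1) else if a = j - 1 then Tp (i - 1)
                else if a < r then Bt a else Tp a))"

definition skd :: "nat \<Rightarrow> nat \<Rightarrow> diag" where "skd r k = transpd r k (k + 1)"
definition ekd :: "nat \<Rightarrow> nat \<Rightarrow> diag" where "ekd r k = eijd r k (k + 1)"

text \<open>The permutation \<sigma> moving strand i (1-indexed) to position 1 and strands 1..i-1 to
 positions 2..i, written 0-indexed.\<close>

definition sigmap :: "nat \<Rightarrow> nat \<Rightarrow> nat" where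
  "sigmap i a = (if a = i - 1 then 0 else if a < i - 1 then a + 1 else a)"

definition sigmad :: "nat \<Rightarrow> nat \<Rightarrow> diag" where
  "sigmad r i = permd r (sigmap i)"

definition sigmainvd :: "nat \<Rightarrow> nat \<Rightarrow> diag" where
  "sigmainvd r i = permd r (inv_into {..<r} (sigmap i))"

text \<open>Formal expressions for morphisms: PoleI = \<I>_0, PoleH = \<H>, Cmp D E = D \<circ> E,
 Tns D B = D \<otimes> B (B a Brauer diagram), formal sums, scalar multiples and zero.\<close>

datatype 'k abt =
    PoleI
  | PoleH
  | Cmp "'k abt" "'k abt"
  | Tns "'k abt" diag
  | Pls "'k abt" "'k abt"
  | Scl 'k "'k abt"
  | Zr nat nat

fun tdom :: "'k abt \<Rightarrow> nat" and tcod :: "'k abt \<Rightarrow> nat" where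
  "tdom PoleI = 0"
| "tdom PoleH = 1"
| "tdom (Cmp d e) = tdom e"
| "tdom (Tns t B) = tdom t + ddom B"
| "tdom (Pls s t) = tdom s"
| "tdom (Scl a t) = tdom t"
| "tdom (Zr n m) = n"
| "tcod PoleI = 0"
| "tcod PoleH = 1"
| "tcod (Cmp d e) = tcod d"
| "tcod (Tns t B) = tcod t + dcod B"
| "tcod (Pls s t) = tcod s"
| "tcod (Scl a t) = tcod t"
| "tcod (Zr n m) = m"

fun wt :: "'k abt \<Rightarrow> bool" where
  "wt PoleI = True"
| "wt PoleH = True"
| "wt (Cmp d e) = (wt d \<and> wt e \<and> tcod e = tdom d)"
| "wt (Tns t B) = (wt t \<and> valid_diag B)"
| "wt (Pls s t) = (wt s \<and> wt t \<and> tdom s = tdom t \<and> tcod s = tcod t)"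
| "wt (Scl a t) = wt t"
| "wt (Zr n m) = True"

definition iota :: "diag \<Rightarrow> 'k abt" where "iota B = Tns PoleI B"
definition IIr :: "nat \<Rightarrow> 'k abt" where "IIr r = iota (idd r)"
definition tminus :: "'k::comm_ring_1 abt \<Rightarrow> 'k abt \<Rightarrow> 'k abt" where
  "tminus a b = Pls a (Scl (-1) b)"

fun tpow :: "nat \<Rightarrow> 'k abt \<Rightarrow> nat \<Rightarrow> 'k abt" where
  "tpow n t 0 = IIr n"
| "tpow n t (Suc l) = Cmp t (tpow n t l)"

fun tsum :: "nat \<Rightarrow> nat \<Rightarrow> 'k abt list \<Rightarrow> 'k abt" where
  "tsum n m [] = Zr n m"
| "tsum n m (x # xs) = Pls x (tsum n m xs)"

definition iotaH :: "'k::comm_ring_1 abt" where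
  "iotaH = tminus (iota crossX) (Cmp (iota cupd) (iota capd))"

definition commut :: "'k::comm_ring_1 abt \<Rightarrow> 'k abt \<Rightarrow> 'k abt" where
  "commut a b = tminus (Cmp a b) (Cmp b a)"

text \<open>Equality of morphisms in AB(\<delta>): the smallest congruence on well-typed expressions
 making the hom-sets K-modules, composition associative, unital and bilinear, the right
 action by Brauer morphisms linear, associative, unital and compatible with composition
 (with closed loops replaced by \<delta>), and imposing the defining relations.\<close>

inductive abeq :: "'k::comm_ring_1 \<Rightarrow> 'k abt \<Rightarrow> 'k abt \<Rightarrow> bool" for \<delta> :: 'k where
  refl: "wt t \<Longrightarrow> abeq \<delta> t t"
| sym: "abeq \<delta> s t \<Longrightarrow> abeq \<delta> t s"
| trans: "abeq \<delta> s t \<Longrightarrow> abeq \<delta> t u \<Longrightarrow> abeq \<delta> s u"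
| cong_cmp: "abeq \<delta> d d' \<Longrightarrow> abeq \<delta> e e' \<Longrightarrow> wt (Cmp d e) \<Longrightarrow> abeq \<delta> (Cmp d e) (Cmp d' e')"
| cong_tns: "abeq \<delta> t t' \<Longrightarrow> valid_diag B \<Longrightarrow> abeq \<delta> (Tns t B) (Tns t' B)"
| cong_pls: "abeq \<delta> s s' \<Longrightarrow> abeq \<delta> t t' \<Longrightarrow> wt (Pls s t) \<Longrightarrow> abeq \<delta> (Pls s t) (Pls s' t')"
| cong_scl: "abeq \<delta> t t' \<Longrightarrow> abeq \<delta> (Scl a t) (Scl a t')"
| pls_assoc: "wt (Pls (Pls s t) u) \<Longrightarrow> abeq \<delta> (Pls (Pls s t) u) (Pls s (Pls t u))"
| pls_comm: "wt (Pls s t) \<Longrightarrow> abeq \<delta> (Pls s t) (Pls t s)"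
| pls_zero: "wt t \<Longrightarrow> abeq \<delta> (Pls t (Zr (tdom t) (tcod t))) t"
| pls_neg: "wt t \<Longrightarrow> abeq \<delta> (Pls t (Scl (-1) t)) (Zr (tdom t) (tcod t))"
| scl_one: "wt t \<Longrightarrow> abeq \<delta> (Scl 1 t) t"
| scl_scl: "wt t \<Longrightarrow> abeq \<delta> (Scl a (Scl b t)) (Scl (a * b) t)"
| scl_add: "wt t \<Longrightarrow> abeq \<delta> (Scl (a + b) t) (Pls (Scl a t) (Scl b t))"
| scl_pls: "wt (Pls s t) \<Longrightarrow> abeq \<delta> (Scl a (Pls s t)) (Pls (Scl a s) (Scl a t))"
| cmp_assoc: "wt (Cmp (Cmp d e) f) \<Longrightarrow> abeq \<delta> (Cmp (Cmp d e) f) (Cmp d (Cmp e f))"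
| id_left: "wt t \<Longrightarrow> abeq \<delta> (Cmp (IIr (tcod t)) t) t"
| id_right: "wt t \<Longrightarrow> abeq \<delta> (Cmp t (IIr (tdom t))) t"
| cmp_pls_l: "wt (Cmp (Pls s t) u) \<Longrightarrow> abeq \<delta> (Cmp (Pls s t) u) (Pls (Cmp s u) (Cmp t u))"
| cmp_pls_r: "wt (Cmp u (Pls s t)) \<Longrightarrow> abeq \<delta> (Cmp u (Pls s t)) (Pls (Cmp u s) (Cmp u t))"
| cmp_scl_l: "wt (Cmp s t) \<Longrightarrow> abeq \<delta> (Cmp (Scl a s) t) (Scl a (Cmp s t))"
| cmp_scl_r: "wt (Cmp s t) \<Longrightarrow> abeq \<delta> (Cmp s (Scl a t)) (Scl a (Cmp s t))"
| tns_pls: "wt (Pls s t) \<Longrightarrow> valid_diag B \<Longrightarrow> abeq \<delta> (Tns (Pls s t) B) (Pls (Tns s B) (Tns t B))"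
| tns_scl: "wt t \<Longrightarrow> valid_diag B \<Longrightarrow> abeq \<delta> (Tns (Scl a t) B) (Scl a (Tns t B))"
| tns_unit: "wt t \<Longrightarrow> abeq \<delta> (Tns t (idd 0)) t"
| tns_tns: "wt t \<Longrightarrow> valid_diag B \<Longrightarrow> valid_diag C \<Longrightarrow>
             abeq \<delta> (Tns (Tns t B) C) (Tns t (dtens B C))"
| interchange: "wt (Cmp d e) \<Longrightarrow> valid_diag B \<Longrightarrow> valid_diag A \<Longrightarrow> dcod A = ddom B \<Longrightarrow>
             abeq \<delta> (Cmp (Tns d B) (Tns e A)) (Scl (\<delta> ^ loops B A) (Tns (Cmp d e) (dcomp B A)))"
| rel_I: "valid_diag B \<Longrightarrow> valid_diag A \<Longrightarrow> dcod A = ddom B \<Longrightarrow>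
             abeq \<delta> (Cmp (Tns PoleI B) (Tns PoleI A)) (Scl (\<delta> ^ loops B A) (Tns PoleI (dcomp B A)))"
| rel_H1: "valid_diag B \<Longrightarrow> valid_diag A \<Longrightarrow> dcod A = ddom B \<Longrightarrow>
             abeq \<delta> (Cmp (Tns PoleH B) (Tns (IIr 1) A)) (Scl (\<delta> ^ loops B A) (Tns PoleH (dcomp B A)))"
| rel_H2: "valid_diag B \<Longrightarrow> valid_diag A \<Longrightarrow> dcod A = ddom B \<Longrightarrow>
             abeq \<delta> (Cmp (Tns (IIr 1) B) (Tns PoleH A)) (Scl (\<delta> ^ loops B A) (Tns PoleH (dcomp B A)))"
| four_term: "abeq \<delta> (commut (Tns PoleH (idd 1))
                 (Pls (Cmp (iota crossX) (Cmp (Tns PoleH (idd 1)) (iota crossX))) iotaH))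
               (Zr 2 2)"
| skew: "abeq \<delta> (Cmp (iota (dtens capd (idd 1))) (Cmp (Tns PoleH crossX) (iota (dtens cupd (idd 1)))))
               (Scl (-1) PoleH)"

definition HH0 :: "nat \<Rightarrow> nat \<Rightarrow> 'k abt" where
  "HH0 r i = Cmp (iota (sigmainvd r i)) (Cmp (Tns PoleH (idd (r - 1))) (iota (sigmad r i)))"

definition HHij :: "nat \<Rightarrow> nat \<Rightarrow> nat \<Rightarrow> 'k::comm_ring_1 abt" where
  "HHij r i j = tminus (iota (transpd r i j)) (iota (eijd r i j))"

definition Theta :: "nat \<Rightarrow> nat \<Rightarrow> 'k::comm_ring_1 abt" where
  "Theta r j = tsum r r (HH0 r j # map (\<lambda>a. HHij r a j) [1..<j])"

definition Zl :: "nat \<Rightarrow> 'k abt" where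
  "Zl l = Cmp (iota capd) (Cmp (Tns (tpow 1 PoleH l) (idd 1)) (iota cupd))"

end

theory Submission
  imports Defs
begin

text \<open>
  A permutation fixing the first strand slides past the pole, so permutation diagrams conjugate
  \<open>H_0i\<close> to \<open>H_0j\<close>, and each relation involving these only has to be checked on the first two strands. The skew-symmetry relation, with a cap
  or cup attached, becomes \<open>e_ij (H_0i + H_0j) = 0 = (H_0i + H_0j) e_ij\<close>, and its analogue
  \<open>e_ij (H_ik + H_jk) = 0 = (H_ik + H_jk) e_ij\<close> is a Brauer identity; the latter also gives the
  four-term relation \<open>[H_ij, H_ik + H_jk] = 0\<close> for Brauer diagrams. For \<open>i < j\<close> the
  summands of \<open>\<Theta>_j\<close> can be grouped so that every summand of \<open>\<Theta>_i\<close> commutes with each group, by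
  disjointness or by a four-term relation; the other parts use the same grouping.
\<close>

section \<open>Composition of Brauer diagrams\<close>

text \<open>Stacking is defined through connectivity and a definite description, so no composite
  evaluates by itself. Tracing strands with a step bound turns an identity of diagrams into a finite
  computation once its result has been guessed. A closed loop never reaches an end; the only
  composite with a loop that occurs, \<open>e_ij\<close> with itself, is therefore treated by hand,
  and it is the source of \<delta> in (e).

  Strands can be added only to the right of the pole. Hence a two-strand relation is first extended
  by identity strands on the right and only then moved to strands \<open>i\<close>, \<open>j\<close>
  by a permutation.

  Parts (b) to (e) concern endomorphisms and become equations in a ring, where bilinearity and
  associativity are automatic. Caps and cups are not endomorphisms, so the consequences of skew
  symmetry and part (a) are explicit chains of \<open>abeq\<close>. In (a), \<open>e_1\<close>
  factors as cup after cap; the inner cap and cup close the connectors up to \<open>Z_l\<close>, an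
  endomorphism of \<open>0\<close>, and the interchange law moves it past the remaining cup.\<close>

lemma in_pts [simp]: "Bt i \<in> pts n m \<longleftrightarrow> i < n" "Tp j \<in> pts n m \<longleftrightarrow> j < m"
  by (auto simp: pts_def)

lemma valid_dmap:
  assumes "valid_diag D" "p \<in> pts (ddom D) (dcod D)"
  shows "dmap D p \<in> pts (ddom D) (dcod D)" "dmap D p \<noteq> p" "dmap D (dmap D p) = p"
  using assms unfolding valid_diag_def by auto

lemma valid_dmap_out: "valid_diag D \<Longrightarrow> p \<notin> pts (ddom D) (dcod D) \<Longrightarrow> dmap D p = p"
  unfolding valid_diag_def by auto

lemma embA_simps [simp]: "embA (Bt i) = L i" "embA (Tp j) = M j"
  and embB_simps [simp]: "embB (Bt i) = M i" "embB (Tp j) = U j"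
  by (auto simp: embA_def embB_def)

lemma embA_eq:
  "L i = embA p \<longleftrightarrow> p = Bt i" "M i = embA p \<longleftrightarrow> p = Tp i" "U i \<noteq> embA p"
  by (cases p; auto)+

lemma embB_eq:
  "U i = embB p \<longleftrightarrow> p = Tp i" "M i = embB p \<longleftrightarrow> p = Bt i" "L i \<noteq> embB p"
  by (cases p; auto)+

lemma cedge_simps:
  "cedge A B (L i) w \<longleftrightarrow> i < ddom A \<and> w = embA (dmap A (Bt i))"
  "cedge A B (U i) w \<longleftrightarrow> i < dcod B \<and> w = embB (dmap B (Tp i))"
  "cedge A B (M i) w \<longleftrightarrow> i < dcod A \<and> w = embA (dmap A (Tp i))
                        \<or> i < ddom B \<and> w = embB (dmap B (Bt i))"
  by (auto simp: cedge_def embA_eq embB_eq)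

text \<open>Traces a strand through the stacked picture: \<open>p\<close> is the point of \<open>A\<close> (of \<open>B\<close> for
 \<open>walkB\<close>) at which the strand enters that diagram, and the number bounds the length of the walk.\<close>

fun walkA :: "diag \<Rightarrow> diag \<Rightarrow> nat \<Rightarrow> pt \<Rightarrow> pt option"
and walkB :: "diag \<Rightarrow> diag \<Rightarrow> nat \<Rightarrow> pt \<Rightarrow> pt option" where
  "walkA A B 0 p = None"
| "walkA A B (Suc n) p = (case dmap A p of Bt i \<Rightarrow> Some (Bt i) | Tp j \<Rightarrow> walkB A B n (Bt j))"
| "walkB A B 0 p = None"
| "walkB A B (Suc n) p = (case dmap B p of Tp k \<Rightarrow> Some (Tp k) | Bt j \<Rightarrow> walkA A B n (Tp j))"

fun endv :: "pt \<Rightarrow> cv" where "endv (Bt i) = L i" | "endv (Tp k) = U k"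

lemma cvpt_endv [simp]: "cvpt (endv q) = q" by (cases q) (auto simp: cvpt_def)

text \<open>The set \<open>W\<close> is the part of the component traversed so far; the only edge that may
 leave it is the one of the starting vertex that belongs to the other diagram.\<close>

lemma walk_component:
  assumes "valid_diag A" "valid_diag B" "dcod A = ddom B"
  shows "walkA A B n p = Some q \<Longrightarrow> p \<in> pts (ddom A) (dcod A) \<Longrightarrow>
     \<exists>W. embA p \<in> W \<and> endv q \<in> W \<and> endv q \<in> cends A B \<and> cconn A B (embA p) (endv q)
       \<and> W \<inter> cends A B \<subseteq> {embA p, endv q}
       \<and> (\<forall>v\<in>W. \<forall>w. cedge A B v w \<longrightarrow> w \<in> W \<or> (\<exists>j. p = Tp j \<and> v = M j \<and> w = embB (dmap B (Bt j))))"
   and "walkB A B n p = Some q \<Longrightarrow> p \<in> pts (ddom B) (dcod B) \<Longrightarrow>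
     \<exists>W. embB p \<in> W \<and> endv q \<in> W \<and> endv q \<in> cends A B \<and> cconn A B (embB p) (endv q)
       \<and> W \<inter> cends A B \<subseteq> {embB p, endv q}
       \<and> (\<forall>v\<in>W. \<forall>w. cedge A B v w \<longrightarrow> w \<in> W \<or> (\<exists>j. p = Bt j \<and> v = M j \<and> w = embA (dmap A (Tp j))))"
  using assms
proof (induction A B n p and A B n p arbitrary: q and q rule: walkA_walkB.induct)
  case (2 A B n p)
  note A = valid_dmap[OF \<open>valid_diag A\<close> \<open>p \<in> _\<close>]
  show ?case
  proof (cases "dmap A p")
    case (Bt i)
    have *: "dmap A (Bt i) = p" "i < ddom A" using A Bt by auto
    have q: "q = Bt i" using \<open>walkA A B (Suc n) p = Some q\<close> Bt by simp
    have "cedge A B (embA p) (L i)" using \<open>p \<in> pts (ddom A) (dcod A)\<close> Bt by (cases p) (auto simp: cedge_simps)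
    then have "cconn A B (embA p) (L i)" unfolding cconn_def by (rule r_into_rtranclp)
    then show ?thesis using * q Bt \<open>p \<in> pts (ddom A) (dcod A)\<close> \<open>dcod A = ddom B\<close>
      by (intro exI[of _ "{embA p, L i}"], cases p) (auto simp: cedge_simps cends_def)
  next
    case (Tp j)
    have *: "dmap A (Tp j) = p" "j < ddom B" using A Tp \<open>dcod A = _\<close> by auto
    have "walkB A B n (Bt j) = Some q" using \<open>walkA A B (Suc n) p = Some q\<close> Tp by simp
    then obtain W where W: "M j \<in> W" "endv q \<in> W" "endv q \<in> cends A B" "cconn A B (M j) (endv q)"
       "W \<inter> cends A B \<subseteq> {M j, endv q}"
       "\<And>v w. v \<in> W \<Longrightarrow> cedge A B v w \<Longrightarrow> w \<in> W \<or> v = M j \<and> w = embA (dmap A (Tp j))"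
      using "2.IH"[OF Tp \<open>walkB A B n (Bt j) = Some q\<close> _ \<open>valid_diag A\<close> \<open>valid_diag B\<close> \<open>dcod A = ddom B\<close> ] *
      by simp blast
    have e: "cedge A B (embA p) (M j)" using \<open>p \<in> pts (ddom A) (dcod A)\<close> Tp by (cases p) (auto simp: cedge_simps)
    then have "cconn A B (embA p) (endv q)" using W(4) unfolding cconn_def by (rule converse_rtranclp_into_rtranclp)
    moreover have "M j \<notin> cends A B" by (auto simp: cends_def)
    \<comment> \<open>The one edge that could leave the set of the induction hypothesis, the
      \<open>A\<close>-edge at \<open>M j\<close>, leads back to \<open>embA p\<close> because
      \<open>dmap A\<close> is an involution. What remains open is the \<open>B\<close>-edge at a
      starting point in the middle row.\<close>
    moreover have "w \<in> insert (embA p) W \<or> (\<exists>j. p = Tp j \<and> v = M j \<and> w = embB (dmap B (Bt j)))"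
      if "v \<in> insert (embA p) W" "cedge A B v w" for v w
      using that W(1) W(6)[of v w] * Tp by (cases p) (auto simp: cedge_simps)
    ultimately show ?thesis using W(2,3,5)
      by (intro exI[of _ "insert (embA p) W"] conjI ballI allI impI) blast+
  qed
next
  case (4 A B n p)
  note B = valid_dmap[OF \<open>valid_diag B\<close> \<open>p \<in> _\<close>]
  show ?case
  proof (cases "dmap B p")
    case (Tp i)
    have *: "dmap B (Tp i) = p" "i < dcod B" using B Tp by auto
    have q: "q = Tp i" using \<open>walkB A B (Suc n) p = Some q\<close> Tp by simp
    have "cedge A B (embB p) (U i)" using \<open>p \<in> pts (ddom B) (dcod B)\<close> Tp by (cases p) (auto simp: cedge_simps)
    then have "cconn A B (embB p) (U i)" unfolding cconn_def by (rule r_into_rtranclp)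
    then show ?thesis using * q Tp \<open>p \<in> pts (ddom B) (dcod B)\<close> \<open>dcod A = ddom B\<close>
      by (intro exI[of _ "{embB p, U i}"], cases p) (auto simp: cedge_simps cends_def)
  next
    case (Bt j)
    have *: "dmap B (Bt j) = p" "j < dcod A" using B Bt \<open>dcod A = _\<close> by auto
    have "walkA A B n (Tp j) = Some q" using \<open>walkB A B (Suc n) p = Some q\<close> Bt by simp
    then obtain W where W: "M j \<in> W" "endv q \<in> W" "endv q \<in> cends A B" "cconn A B (M j) (endv q)"
       "W \<inter> cends A B \<subseteq> {M j, endv q}"
       "\<And>v w. v \<in> W \<Longrightarrow> cedge A B v w \<Longrightarrow> w \<in> W \<or> v = M j \<and> w = embB (dmap B (Bt j))"
      using "4.IH"[OF Bt \<open>walkA A B n (Tp j) = Some q\<close> _ \<open>valid_diag A\<close> \<open>valid_diag B\<close> \<open>dcod A = ddom B\<close> ] *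
      by simp blast
    have e: "cedge A B (embB p) (M j)" using \<open>p \<in> pts (ddom B) (dcod B)\<close> Bt by (cases p) (auto simp: cedge_simps)
    then have "cconn A B (embB p) (endv q)" using W(4) unfolding cconn_def by (rule converse_rtranclp_into_rtranclp)
    moreover have "M j \<notin> cends A B" by (auto simp: cends_def)
    moreover have "w \<in> insert (embB p) W \<or> (\<exists>j. p = Bt j \<and> v = M j \<and> w = embA (dmap A (Tp j)))"
      if "v \<in> insert (embB p) W" "cedge A B v w" for v w
      using that W(1) W(6)[of v w] * Bt by (cases p) (auto simp: cedge_simps)
    ultimately show ?thesis using W(2,3,5)
      by (intro exI[of _ "insert (embB p) W"] conjI ballI allI impI) blast+
  qed
qed simp_all

text \<open>The exceptional edge in \<open>walk_component\<close> exists only for a start in the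
  middle row. From an outer end the set \<open>W\<close> is closed under edges, hence contains the
  component, and it has no ends besides the two of the walk; this determines the definite
  description.\<close>

lemma partner_eq:
  assumes "valid_diag A" "valid_diag B" "dcod A = ddom B"
  shows "i < ddom A \<Longrightarrow> walkA A B n (Bt i) = Some q \<Longrightarrow> q \<noteq> Bt i \<Longrightarrow> partner A B (L i) = q"
    and "k < dcod B \<Longrightarrow> walkB A B n (Tp k) = Some q \<Longrightarrow> q \<noteq> Tp k \<Longrightarrow> partner A B (U k) = q"
proof -
  have key: "partner A B x = q"
    if W: "x \<in> W" "endv q \<in> cends A B" "cconn A B x (endv q)" "W \<inter> cends A B \<subseteq> {x, endv q}"
       "\<And>v w. v \<in> W \<Longrightarrow> cedge A B v w \<Longrightarrow> w \<in> W" and "endv q \<noteq> x" for x q W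
  proof -
    have "y \<in> W" if "cconn A B x y" for y
      using that unfolding cconn_def by (induction rule: rtranclp_induct) (use W in auto)
    then have "(THE y. y \<in> cends A B \<and> y \<noteq> x \<and> cconn A B x y) = endv q"
      using W that(6) by (intro the_equality) auto
    then show ?thesis by (simp add: partner_def)
  qed
  show "partner A B (L i) = q" if "i < ddom A" "walkA A B n (Bt i) = Some q" "q \<noteq> Bt i"
    using walk_component(1)[OF assms that(2)] that(1,3) by (cases q) (auto intro!: key)
  show "partner A B (U k) = q" if "k < dcod B" "walkB A B n (Tp k) = Some q" "q \<noteq> Tp k"
    using walk_component(2)[OF assms that(2)] that(1,3) by (cases q) (auto intro!: key)
qed

lemma diag_eqI:
  "ddom C = ddom D \<Longrightarrow> dcod C = dcod D \<Longrightarrow> (\<And>p. dmap C p = dmap D p) \<Longrightarrow> C = D"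
  by (cases C; cases D) (auto simp: ddom_def dcod_def dmap_def)

lemma dcomp_sel [simp]: "ddom (dcomp B A) = ddom A" "dcod (dcomp B A) = dcod B"
  by (auto simp: dcomp_def ddom_def dcod_def)

text \<open>Makes composition computable: simplification traces each end and compares with the
  guessed result \<open>C\<close>. The bound \<open>n\<close> is unfolded into successors, and one
  value has to serve all strands.\<close>

lemma dcomp_eqI:
  assumes "valid_diag A" "valid_diag B" "valid_diag C"
    and "dcod A = ddom B" "ddom C = ddom A" "dcod C = dcod B"
    and a: "\<And>i. i < ddom A \<Longrightarrow> walkA A B n (Bt i) = Some (dmap C (Bt i))"
    and b: "\<And>k. k < dcod B \<Longrightarrow> walkB A B n (Tp k) = Some (dmap C (Tp k))"
  shows "dcomp B A = C"
proof (rule diag_eqI)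
  fix p
  have "partner A B (L i) = dmap C (Bt i)" if "i < ddom A" for i
    using that assms by (intro partner_eq a valid_dmap) auto
  moreover have "partner A B (U k) = dmap C (Tp k)" if "k < dcod B" for k
    using that assms by (intro partner_eq b valid_dmap) auto
  moreover have "dmap C p = p" if "p \<notin> pts (ddom A) (dcod B)"
    using that assms by (auto intro: valid_dmap_out)
  ultimately show "dmap (dcomp B A) p = dmap C p"
    by (cases p) (auto simp: dcomp_def dmap_def)
qed (use assms in auto)

text \<open>A counted component contains a middle point and no end, so a terminating walk from every
  middle point rules it out.\<close>

lemma loops_eq_0I:
  assumes "valid_diag A" "valid_diag B" "dcod A = ddom B"
    and "\<And>j. j < dcod A \<Longrightarrow> walkA A B n (Tp j) \<noteq> None"
  shows "loops B A = 0"
proof -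
  have "Collect (cconn A B (M j)) \<inter> cends A B \<noteq> {}" if "j < dcod A" for j
  proof -
    obtain q where "walkA A B n (Tp j) = Some q" using \<open>j < dcod A\<close> assms(4) by blast
    from walk_component(1)[OF assms(1-3) this] that show ?thesis by auto
  qed
  then have "{C. \<exists>j<dcod A. C = Collect (cconn A B (M j)) \<and> C \<inter> cends A B = {}} = {}" by auto
  then show ?thesis unfolding loops_def by simp
qed

lemma valid_diagI:
  assumes "\<And>i. i < ddom D \<Longrightarrow> dmap D (Bt i) \<in> pts (ddom D) (dcod D) \<and> dmap D (Bt i) \<noteq> Bt i \<and> dmap D (dmap D (Bt i)) = Bt i"
    and "\<And>i. i < dcod D \<Longrightarrow> dmap D (Tp i) \<in> pts (ddom D) (dcod D) \<and> dmap D (Tp i) \<noteq> Tp i \<and> dmap D (dmap D (Tp i)) = Tp i"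
    and "\<And>i. i \<ge> ddom D \<Longrightarrow> dmap D (Bt i) = Bt i"
    and "\<And>i. i \<ge> dcod D \<Longrightarrow> dmap D (Tp i) = Tp i"
  shows "valid_diag D"
  unfolding valid_diag_def
proof (intro conjI allI impI ballI)
  fix p
  show "dmap D p \<in> pts (ddom D) (dcod D)" "dmap D p \<noteq> p" "dmap D (dmap D p) = p"
    if "p \<in> pts (ddom D) (dcod D)" using that assms(1,2) by (cases p; force)+
  show "dmap D p = p" if "p \<notin> pts (ddom D) (dcod D)"
    using that assms(3,4) by (cases p) auto
qed

lemma diag_eqI2:
  assumes "ddom C = ddom D" "dcod C = dcod D" "\<And>i. dmap C (Bt i) = dmap D (Bt i)" "\<And>i. dmap C (Tp i) = dmap D (Tp i)"
  shows "C = D"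
proof (rule diag_eqI)
  show "dmap C p = dmap D p" for p using assms by (cases p) auto
qed (use assms in auto)

section \<open>Permutation diagrams and arc diagrams\<close>

definition pbij :: "nat \<Rightarrow> (nat \<Rightarrow> nat) \<Rightarrow> bool" where
  "pbij r \<pi> \<longleftrightarrow> bij_betw \<pi> {..<r} {..<r}"

lemma pbij_less: "pbij r \<pi> \<Longrightarrow> i < r \<Longrightarrow> \<pi> i < r"
  by (auto simp: pbij_def bij_betw_def)

lemma pbij_eq_iff: "pbij r \<pi> \<Longrightarrow> i < r \<Longrightarrow> j < r \<Longrightarrow> \<pi> i = \<pi> j \<longleftrightarrow> i = j"
  by (auto simp: pbij_def bij_betw_def inj_on_def)

lemma pbijE: "pbij r \<pi> \<Longrightarrow> k < r \<Longrightarrow> (\<And>i. i < r \<Longrightarrow> k = \<pi> i \<Longrightarrow> thesis) \<Longrightarrow> thesis"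
  by (auto simp: pbij_def bij_betw_def)

lemma pbij_inv [simp]: "pbij r \<pi> \<Longrightarrow> i < r \<Longrightarrow> inv_into {..<r} \<pi> (\<pi> i) = i"
  by (auto simp: pbij_def bij_betw_def)

lemma pbij_inv_less [simp]: "pbij r \<pi> \<Longrightarrow> k < r \<Longrightarrow> inv_into {..<r} \<pi> k < r"
  by (rule pbijE[of r \<pi> k]) auto

lemma pbij_f_inv [simp]: "pbij r \<pi> \<Longrightarrow> k < r \<Longrightarrow> \<pi> (inv_into {..<r} \<pi> k) = k"
  by (rule pbijE[of r \<pi> k]) auto

lemma pbij_inv_eq_iff: "pbij r \<pi> \<Longrightarrow> k < r \<Longrightarrow> i < r \<Longrightarrow> inv_into {..<r} \<pi> k = i \<longleftrightarrow> k = \<pi> i"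
  by (auto elim: pbijE)

lemma pbij_comp: "pbij r \<pi> \<Longrightarrow> pbij r \<rho> \<Longrightarrow> pbij r (\<pi> \<circ> \<rho>)"
  unfolding pbij_def by (rule bij_betw_trans)

lemma pbij_inv_into: "pbij r \<pi> \<Longrightarrow> pbij r (inv_into {..<r} \<pi>)"
  unfolding pbij_def by (rule bij_betw_inv_into)

lemma pbij_id: "pbij r id"
  by (simp add: pbij_def)

lemma pbij_tr: "i < r \<Longrightarrow> j < r \<Longrightarrow> pbij r (tr i j)"
  unfolding pbij_def by (rule bij_betw_byWitness[where f' = "tr i j"]) (auto simp: tr_def)

lemma permd_sel [simp]: "ddom (permd r \<pi>) = r" "dcod (permd r \<pi>) = r"
  by (auto simp: permd_def ddom_def dcod_def)

lemma dmap_permd [simp]: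
  "dmap (permd r \<pi>) (Bt i) = (if i < r then Tp (\<pi> i) else Bt i)"
  "dmap (permd r \<pi>) (Tp j) = (if j < r then Bt (inv_into {..<r} \<pi> j) else Tp j)"
  by (auto simp: permd_def dmap_def)

lemma valid_permd [simp]: "pbij r \<pi> \<Longrightarrow> valid_diag (permd r \<pi>)"
  by (rule valid_diagI) (auto simp: pbij_less)

lemma permd_cong: "(\<And>i. i < r \<Longrightarrow> \<pi> i = \<rho> i) \<Longrightarrow> permd r \<pi> = permd r \<rho>"
proof (rule diag_eqI2)
  assume *: "\<And>i. i < r \<Longrightarrow> \<pi> i = \<rho> i"
  \<comment> \<open>\<open>inv_into\<close> is a choice over this predicate, so equal predicates
    give equal values even at a point without preimage.\<close>
  then have "(\<lambda>y. y \<in> {..<r} \<and> \<pi> y = j) = (\<lambda>y. y \<in> {..<r} \<and> \<rho> y = j)" for j by auto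
  then show "dmap (permd r \<pi>) (Tp j) = dmap (permd r \<rho>) (Tp j)" for j
    by (simp add: inv_into_def)
qed auto

lemma permd_eqI:
  assumes "valid_diag D" "ddom D = r" "dcod D = r" "pbij r \<pi>"
    and "\<And>i. i < r \<Longrightarrow> dmap D (Bt i) = Tp (\<pi> i)"
  shows "D = permd r \<pi>"
proof (rule diag_eqI)
  fix p
  have "dmap D (Tp j) = Bt (inv_into {..<r} \<pi> j)" if "j < r" for j
    using valid_dmap(3)[OF assms(1), of "Bt (inv_into {..<r} \<pi> j)"] assms that by simp
  moreover have "p \<notin> pts r r \<Longrightarrow> dmap D p = p" using assms valid_dmap_out by auto
  ultimately show "dmap D p = dmap (permd r \<pi>) p"
    using assms by (cases p) (auto elim: pbijE[where \<pi> = \<pi>])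
qed (use assms in auto)

lemma idd_permd: "idd r = permd r id"
  using pbij_inv[OF pbij_id, of _ r]
  by (intro diag_eqI2) (auto simp: idd_def ddom_def dcod_def dmap_def permd_def)

lemma idd_sel [simp]: "ddom (idd r) = r" "dcod (idd r) = r"
  by (auto simp: idd_permd)

lemma valid_idd [simp]: "valid_diag (idd r)"
  by (simp add: idd_permd pbij_id)

lemma dmap_idd [simp]:
  "dmap (idd r) (Bt i) = (if i < r then Tp i else Bt i)"
  "dmap (idd r) (Tp i) = (if i < r then Bt i else Tp i)"
  by (auto simp: idd_def dmap_def)

lemma dcomp_idd_left: "valid_diag D \<Longrightarrow> dcomp (idd (dcod D)) D = D"
  by (rule dcomp_eqI[where n = 3])
    (auto simp: numeral_3_eq_3 split: pt.splits dest: valid_dmap(1)[of D "Bt _"] valid_dmap(1)[of D "Tp _"])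

lemma loops_idd_left: "valid_diag D \<Longrightarrow> loops (idd (dcod D)) D = 0"
  by (rule loops_eq_0I[where n = 3])
    (auto simp: numeral_3_eq_3 split: pt.splits dest: valid_dmap(1)[of D "Bt _"] valid_dmap(1)[of D "Tp _"])

lemma dcomp_idd_right: "valid_diag D \<Longrightarrow> dcomp D (idd (ddom D)) = D"
  by (rule dcomp_eqI[where n = 3])
    (auto simp: numeral_3_eq_3 split: pt.splits dest: valid_dmap(1)[of D "Bt _"] valid_dmap(1)[of D "Tp _"])

lemma loops_idd_right: "valid_diag D \<Longrightarrow> loops D (idd (ddom D)) = 0"
  by (rule loops_eq_0I[where n = 2]) (auto simp: numeral_2_eq_2)

lemma dcomp_permd: "pbij r \<pi> \<Longrightarrow> pbij r \<rho> \<Longrightarrow> dcomp (permd r \<pi>) (permd r \<rho>) = permd r (\<pi> \<circ> \<rho>)"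
proof (rule dcomp_eqI[where n = 2])
  assume a: "pbij r \<pi>" "pbij r \<rho>"
  fix k assume "k < dcod (permd r \<pi>)"
  then obtain i where "k = (\<pi> \<circ> \<rho>) i" "i < r" using pbijE[OF pbij_comp[OF a]] by auto
  then show "walkB (permd r \<rho>) (permd r \<pi>) 2 (Tp k) = Some (dmap (permd r (\<pi> \<circ> \<rho>)) (Tp k))"
    using a pbij_inv[OF pbij_comp[OF a], of i] by (simp add: numeral_2_eq_2 pbij_less)
qed (auto simp: numeral_2_eq_2 pbij_less pbij_comp)

lemma loops_permd_left:
  assumes "pbij r \<pi>" "valid_diag A" "dcod A = r"
  shows "loops (permd r \<pi>) A = 0"
  using assms by (intro loops_eq_0I[where n = 2])
    (auto simp: numeral_2_eq_2 split: pt.splits dest: valid_dmap(1)[of A "Tp _"])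

lemma loops_permd_right: "pbij r \<pi> \<Longrightarrow> valid_diag B \<Longrightarrow> ddom B = r \<Longrightarrow> loops B (permd r \<pi>) = 0"
  by (rule loops_eq_0I[where n = 2]) (auto simp: numeral_2_eq_2)

text \<open>Strands are 0-indexed from here on, whereas \<open>eijd\<close>, \<open>transpd\<close>, \<open>HH0\<close>, \<open>HHij\<close> and
 \<open>Theta\<close> count from 1.\<close>

definition ed :: "nat \<Rightarrow> nat \<Rightarrow> nat \<Rightarrow> diag" where "ed r i j = eijd r (Suc i) (Suc j)"

lemma ed_sel [simp]: "ddom (ed r i j) = r" "dcod (ed r i j) = r"
  by (auto simp: ed_def eijd_def ddom_def dcod_def)

lemma dmap_ed [simp]:
  "dmap (ed r i j) (Bt a) = (if a = i then Bt j else if a = j then Bt i else if a < r then Tp a else Bt a)"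
  "dmap (ed r i j) (Tp a) = (if a = i then Tp j else if a = j then Tp i else if a < r then Bt a else Tp a)"
  by (auto simp: ed_def eijd_def dmap_def)

lemma valid_ed [simp]: "i < r \<Longrightarrow> j < r \<Longrightarrow> i \<noteq> j \<Longrightarrow> valid_diag (ed r i j)"
  by (rule valid_diagI) auto

lemma ed_commute: "ed r i j = ed r j i"
  by (rule diag_eqI2) auto

text \<open>Common normal form of \<open>\<pi>\<close> after \<open>e_ij\<close> and of the arc
  diagram at \<open>\<pi> i\<close>, \<open>\<pi> j\<close> after \<open>\<pi>\<close>. Reducing
  both composites to it yields the conjugation rule for arcs.\<close>

definition ped :: "nat \<Rightarrow> (nat \<Rightarrow> nat) \<Rightarrow> nat \<Rightarrow> nat \<Rightarrow> diag" where
  "ped r \<pi> i j = (r, r, \<lambda>p. case p of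
      Bt a \<Rightarrow> if a = i then Bt j else if a = j then Bt i else if a < r then Tp (\<pi> a) else Bt a
    | Tp k \<Rightarrow> if k < r then
               (let a = inv_into {..<r} \<pi> k in
                if a = i then Tp (\<pi> j) else if a = j then Tp (\<pi> i) else Bt a)
             else Tp k)"

lemma ped_sel [simp]: "ddom (ped r \<pi> i j) = r" "dcod (ped r \<pi> i j) = r"
  by (auto simp: ped_def ddom_def dcod_def)

lemma dmap_ped [simp]:
  "dmap (ped r \<pi> i j) (Bt a) = (if a = i then Bt j else if a = j then Bt i else if a < r then Tp (\<pi> a) else Bt a)"
  "k < r \<Longrightarrow> dmap (ped r \<pi> i j) (Tp k) = (let a = inv_into {..<r} \<pi> k in
                if a = i then Tp (\<pi> j) else if a = j then Tp (\<pi> i) else Bt a)"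
  "k \<ge> r \<Longrightarrow> dmap (ped r \<pi> i j) (Tp k) = Tp k"
  by (auto simp: ped_def dmap_def)

lemma valid_ped [simp]:
  "pbij r \<pi> \<Longrightarrow> i < r \<Longrightarrow> j < r \<Longrightarrow> i \<noteq> j \<Longrightarrow> valid_diag (ped r \<pi> i j)"
  by (rule valid_diagI) (auto simp: pbij_less pbij_eq_iff pbij_inv_eq_iff Let_def)

lemma dcomp_permd_ed:
  assumes "pbij r \<pi>" "i < r" "j < r" "i \<noteq> j"
  shows "dcomp (permd r \<pi>) (ed r i j) = ped r \<pi> i j"
  by (rule dcomp_eqI[where n = 3]) (use assms in \<open>auto simp: numeral_3_eq_3 pbij_less pbij_inv_eq_iff Let_def\<close>)

lemma dcomp_ed_permd:
  assumes "pbij r \<pi>" "i < r" "j < r" "i \<noteq> j"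
  shows "dcomp (ed r (\<pi> i) (\<pi> j)) (permd r \<pi>) = ped r \<pi> i j"
  by (rule dcomp_eqI[where n = 3])
    (use assms in \<open>auto simp: numeral_3_eq_3 pbij_less pbij_eq_iff pbij_inv_eq_iff Let_def\<close>)

lemma tr_simps [simp]: "tr i j i = j" "tr i j j = i" "k \<noteq> i \<Longrightarrow> k \<noteq> j \<Longrightarrow> tr i j k = k" "tr i j (tr i j k) = k"
  by (auto simp: tr_def)

lemma inv_tr: "i < r \<Longrightarrow> j < r \<Longrightarrow> k < r \<Longrightarrow> inv_into {..<r} (tr i j) k = tr i j k"
  using pbij_inv[OF pbij_tr, of i r j "tr i j k"] pbij_less[OF pbij_tr, of i r j k] by simp

text \<open>Crossing the two ends of an arc leaves the arc unchanged.\<close>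

lemma ped_tr: "i < r \<Longrightarrow> j < r \<Longrightarrow> i \<noteq> j \<Longrightarrow> ped r (tr i j) i j = ed r i j"
proof (rule diag_eqI)
  fix p assume "i < r" "j < r" "i \<noteq> j"
  then show "dmap (ped r (tr i j) i j) p = dmap (ed r i j) p"
    by (cases p; cases "p \<in> pts r r") (auto simp: inv_tr tr_def)
qed auto

lemma dcomp_ed_adjacent:
  assumes "i < r" "j < r" "k < r" "distinct [i, j, k]"
  shows "dcomp (ed r i j) (ed r j k) = ped r (tr i k) k j"
  \<comment> \<open>The bound 4 comes from the strand starting at bottom \<open>i\<close>: it runs
    through \<open>e_jk\<close>, \<open>e_ij\<close>, \<open>e_jk\<close> and \<open>e_ij\<close> in
    turn before it leaves at top \<open>k\<close>.\<close>
  by (rule dcomp_eqI[where n = 4])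
    (use assms in \<open>auto simp: eval_nat_numeral pbij_tr inv_tr tr_def\<close>)

lemma loops_ed_adjacent:
  assumes "i < r" "j < r" "k < r" "distinct [i, j, k]"
  shows "loops (ed r i j) (ed r j k) = 0"
  by (rule loops_eq_0I[where n = 4]) (use assms in \<open>auto simp: eval_nat_numeral\<close>)

lemma dcomp_ed_self:
  assumes "i < r" "j < r" "i \<noteq> j"
  shows "dcomp (ed r i j) (ed r i j) = ed r i j"
  by (rule dcomp_eqI[where n = 3]) (use assms in \<open>auto simp: numeral_3_eq_3\<close>)

definition eed :: "nat \<Rightarrow> nat \<Rightarrow> nat \<Rightarrow> nat \<Rightarrow> nat \<Rightarrow> diag" where
  "eed r i j k l = (r, r, \<lambda>p. case p of
      Bt a \<Rightarrow> if a \<in> {i, j} then Bt (tr i j a) else if a \<in> {k, l} then Bt (tr k l a)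
              else if a < r then Tp a else Bt a
    | Tp a \<Rightarrow> if a \<in> {i, j} then Tp (tr i j a) else if a \<in> {k, l} then Tp (tr k l a)
              else if a < r then Bt a else Tp a)"

lemma eed_sel [simp]: "ddom (eed r i j k l) = r" "dcod (eed r i j k l) = r"
  by (auto simp: eed_def ddom_def dcod_def)

lemma dmap_eed [simp]:
  "dmap (eed r i j k l) (Bt a) = (if a \<in> {i, j} then Bt (tr i j a) else if a \<in> {k, l} then Bt (tr k l a)
              else if a < r then Tp a else Bt a)"
  "dmap (eed r i j k l) (Tp a) = (if a \<in> {i, j} then Tp (tr i j a) else if a \<in> {k, l} then Tp (tr k l a)
              else if a < r then Bt a else Tp a)"
  by (auto simp: eed_def dmap_def)

lemma dcomp_ed_disjoint:
  assumes "i < r" "j < r" "k < r" "l < r" "distinct [i, j, k, l]"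
  shows "dcomp (ed r i j) (ed r k l) = eed r i j k l"
proof (rule dcomp_eqI[where n = 4])
  show "valid_diag (eed r i j k l)" by (rule valid_diagI) (use assms in auto)
qed (use assms in \<open>auto simp: eval_nat_numeral\<close>)

lemma loops_ed_disjoint:
  assumes "i < r" "j < r" "k < r" "l < r" "distinct [i, j, k, l]"
  shows "loops (ed r i j) (ed r k l) = 0"
  by (rule loops_eq_0I[where n = 4]) (use assms in \<open>auto simp: eval_nat_numeral\<close>)

lemma eed_commute: "distinct [i, j, k, l] \<Longrightarrow> eed r i j k l = eed r k l i j"
  by (rule diag_eqI2) auto

text \<open>No walk terminates on a closed loop, so the components are found directly:
  \<open>M i\<close> and \<open>M j\<close> form one without ends, while every other middle point is
  joined to the bottom point below it.\<close>

lemma loops_ed_self: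
  assumes "i < r" "j < r" "i \<noteq> j"
  shows "loops (ed r i j) (ed r i j) = 1"
proof -
  let ?A = "ed r i j"
  have e: "cconn ?A ?A (M i) (M j)" "cconn ?A ?A (M j) (M i)"
    unfolding cconn_def by (rule r_into_rtranclp; use assms in \<open>simp add: cedge_simps\<close>)+
  have cl: "y \<in> {M i, M j}" if "cconn ?A ?A x y" "x \<in> {M i, M j}" for x y
    using that unfolding cconn_def
    by (induction rule: rtranclp_induct) (use assms in \<open>auto simp: cedge_simps\<close>)
  have refl: "cconn ?A ?A x x" for x by (simp add: cconn_def)
  have C: "Collect (cconn ?A ?A x) = {M i, M j}" if "x \<in> {M i, M j}" for x
    using that cl[of x] e refl[of x] by auto
  have *: "Collect (cconn ?A ?A (M m)) \<inter> cends ?A ?A \<noteq> {}" if "m < r" "m \<notin> {i, j}" for m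
  proof -
    have "cconn ?A ?A (M m) (L m)"
      unfolding cconn_def by (rule r_into_rtranclp) (use assms that in \<open>simp add: cedge_simps\<close>)
    then show ?thesis using that by (auto simp: cends_def)
  qed
  have "{C. \<exists>m<r. C = Collect (cconn ?A ?A (M m)) \<and> C \<inter> cends ?A ?A = {}} = {{M i, M j}}"
    (is "?S = _")
  proof (intro equalityI subsetI)
    show "X \<in> {{M i, M j}}" if "X \<in> ?S" for X using that * C by auto
    have "{M i, M j} \<inter> cends ?A ?A = {}" by (auto simp: cends_def)
    then show "X \<in> ?S" if "X \<in> {{M i, M j}}" for X using that C[of "M i"] assms by auto
  qed
  then show ?thesis unfolding loops_def by simp
qed

section \<open>The endomorphism rings\<close>

declare abeq.trans [trans]

abbreviation endo :: "nat \<Rightarrow> 'k abt \<Rightarrow> bool" where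
  "endo r t \<equiv> wt t \<and> tdom t = r \<and> tcod t = r"

lemma cmpL: "abeq \<delta> d d' \<Longrightarrow> wt d \<Longrightarrow> wt e \<Longrightarrow> tcod e = tdom d \<Longrightarrow> abeq \<delta> (Cmp d e) (Cmp d' e)"
  by (intro abeq.cong_cmp abeq.refl) auto

lemma cmpR: "abeq \<delta> e e' \<Longrightarrow> wt d \<Longrightarrow> wt e \<Longrightarrow> tcod e = tdom d \<Longrightarrow> abeq \<delta> (Cmp d e) (Cmp d e')"
  by (intro abeq.cong_cmp abeq.refl) auto

text \<open>No rule of \<open>abeq\<close> composes or tensors with zero directly. Bilinearity shows
  that such an expression is additively idempotent, and this makes it zero.\<close>

lemma abeq_cancel:
  assumes "wt t" "abeq \<delta> (Pls t t) t"
  shows "abeq \<delta> t (Zr (tdom t) (tcod t))"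
proof -
  let ?n = "Scl (-1) t" and ?z = "Zr (tdom t) (tcod t)"
  have "abeq \<delta> t (Pls t ?z)" using assms by (intro abeq.sym[OF abeq.pls_zero])
  also have "abeq \<delta> \<dots> (Pls t (Pls t ?n))"
    using assms by (intro abeq.cong_pls abeq.refl abeq.sym[OF abeq.pls_neg]) auto
  also have "abeq \<delta> \<dots> (Pls (Pls t t) ?n)" using assms by (intro abeq.sym[OF abeq.pls_assoc]) auto
  also have "abeq \<delta> \<dots> (Pls t ?n)" using assms by (intro abeq.cong_pls abeq.refl) auto
  also have "abeq \<delta> \<dots> ?z" using assms by (intro abeq.pls_neg)
  finally show ?thesis .
qed

lemma Zr_idem: "abeq \<delta> (Pls (Zr n m) (Zr n m)) (Zr n m)"
  using abeq.pls_zero[of "Zr n m" \<delta>] by simp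

lemma Cmp_Zr:
  assumes "wt t" "tcod t = m"
  shows "abeq \<delta> (Cmp (Zr m n) t) (Zr (tdom t) n)"
proof -
  have "abeq \<delta> (Pls (Cmp (Zr m n) t) (Cmp (Zr m n) t)) (Cmp (Pls (Zr m n) (Zr m n)) t)"
    using assms by (intro abeq.sym[OF abeq.cmp_pls_l]) auto
  also have "abeq \<delta> \<dots> (Cmp (Zr m n) t)" using assms by (intro cmpL Zr_idem) auto
  finally show ?thesis using abeq_cancel[of "Cmp (Zr m n) t" \<delta>] assms by simp
qed

lemma Tns_Zr:
  assumes "valid_diag B"
  shows "abeq \<delta> (Tns (Zr n m) B) (Zr (n + ddom B) (m + dcod B))"
proof -
  have "abeq \<delta> (Pls (Tns (Zr n m) B) (Tns (Zr n m) B)) (Tns (Pls (Zr n m) (Zr n m)) B)"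
    using assms by (intro abeq.sym[OF abeq.tns_pls]) auto
  also have "abeq \<delta> \<dots> (Tns (Zr n m) B)" using assms by (intro abeq.cong_tns Zr_idem) auto
  finally show ?thesis using abeq_cancel[of "Tns (Zr n m) B" \<delta>] assms by simp
qed

text \<open>Type classes cannot depend on \<open>\<delta>\<close> and \<open>r\<close>, so the endomorphism rings
 \<open>End(r)\<close> over all \<open>(\<delta>, r)\<close> are bundled into a single ring, their product; \<open>el\<close> below
 embeds each of them as a factor.\<close>

definition famrel :: "('k::comm_ring_1 \<Rightarrow> nat \<Rightarrow> 'k abt) \<Rightarrow> ('k \<Rightarrow> nat \<Rightarrow> 'k abt) \<Rightarrow> bool" where
  "famrel f g \<longleftrightarrow> (\<forall>\<delta> r. endo r (f \<delta> r) \<and> endo r (g \<delta> r) \<and> abeq \<delta> (f \<delta> r) (g \<delta> r))"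

\<comment> \<open>Partial, because a family with an ill-typed member is not related to itself. All
  elements of the ring are thus represented by well-typed families, as the typing premises of the
  \<open>abeq\<close> rules require.\<close>
quotient_type (overloaded) 'k endos = "'k::comm_ring_1 \<Rightarrow> nat \<Rightarrow> 'k abt" / partial: famrel
proof (rule part_equivpI)
  show "\<exists>f. famrel f f"
    by (rule exI[of _ "\<lambda>\<delta> r. Zr r r"]) (auto simp: famrel_def intro: abeq.refl)
  show "symp famrel" by (auto simp: famrel_def symp_def intro: abeq.sym)
  show "transp famrel" unfolding famrel_def transp_def by (blast intro: abeq.trans)
qed

instantiation endos :: (comm_ring_1) ring
begin

lift_definition zero_endos :: "'a endos" is "\<lambda>\<delta> r. Zr r r"
  by (auto simp: famrel_def intro: abeq.refl)
lift_definition plus_endos :: "'a endos \<Rightarrow> 'a endos \<Rightarrow> 'a endos" is "\<lambda>f g \<delta> r. Pls (f \<delta> r) (g \<delta> r)"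
  by (auto simp: famrel_def intro: abeq.cong_pls)
lift_definition times_endos :: "'a endos \<Rightarrow> 'a endos \<Rightarrow> 'a endos" is "\<lambda>f g \<delta> r. Cmp (f \<delta> r) (g \<delta> r)"
  by (auto simp: famrel_def intro: abeq.cong_cmp)
lift_definition uminus_endos :: "'a endos \<Rightarrow> 'a endos" is "\<lambda>f \<delta> r. Scl (-1) (f \<delta> r)"
  by (auto simp: famrel_def intro: abeq.cong_scl)
definition minus_endos :: "'a endos \<Rightarrow> 'a endos \<Rightarrow> 'a endos" where "minus_endos a b = a + - b"

instance
proof
  fix a b c :: "'a endos"
  show "a + b + c = a + (b + c)"
    by transfer (auto simp: famrel_def intro: abeq.pls_assoc)
  show "a + b = b + a" by transfer (auto simp: famrel_def intro: abeq.pls_comm)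
  show "0 + a = a"
  proof (transfer, unfold famrel_def, intro allI conjI)
    fix f :: "'a \<Rightarrow> nat \<Rightarrow> 'a abt" and \<delta> r
    assume "\<forall>\<delta> r. endo r (f \<delta> r) \<and> endo r (f \<delta> r) \<and> abeq \<delta> (f \<delta> r) (f \<delta> r)"
    then have f: "endo r (f \<delta> r)" by blast
    have "abeq \<delta> (Pls (Zr r r) (f \<delta> r)) (Pls (f \<delta> r) (Zr r r))" using f by (intro abeq.pls_comm) auto
    also have "abeq \<delta> \<dots> (f \<delta> r)" using abeq.pls_zero[of "f \<delta> r" \<delta>] f by auto
    finally show "abeq \<delta> (Pls (Zr r r) (f \<delta> r)) (f \<delta> r)" .
  qed auto
  show "- a + a = 0"
  proof (transfer, unfold famrel_def, intro allI conjI)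
    fix f :: "'a \<Rightarrow> nat \<Rightarrow> 'a abt" and \<delta> r
    assume "\<forall>\<delta> r. endo r (f \<delta> r) \<and> endo r (f \<delta> r) \<and> abeq \<delta> (f \<delta> r) (f \<delta> r)"
    then have f: "endo r (f \<delta> r)" by blast
    have "abeq \<delta> (Pls (Scl (-1) (f \<delta> r)) (f \<delta> r)) (Pls (f \<delta> r) (Scl (-1) (f \<delta> r)))"
      using f by (intro abeq.pls_comm) auto
    also have "abeq \<delta> \<dots> (Zr r r)" using abeq.pls_neg[of "f \<delta> r" \<delta>] f by auto
    finally show "abeq \<delta> (Pls (Scl (-1) (f \<delta> r)) (f \<delta> r)) (Zr r r)" .
  qed auto
  show "a - b = a + - b" by (rule minus_endos_def)
  show "a * b * c = a * (b * c)" by transfer (auto simp: famrel_def intro: abeq.cmp_assoc)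
  show "(a + b) * c = a * c + b * c" by transfer (auto simp: famrel_def intro: abeq.cmp_pls_l)
  show "a * (b + c) = a * b + a * c" by transfer (auto simp: famrel_def intro: abeq.cmp_pls_r)
qed

end

text \<open>Zero in all other factors makes the embedding additive and multiplicative, but the
  identity of \<open>End(r)\<close> becomes a mere idempotent, \<open>perm_el \<delta> r id\<close>
  below.\<close>

definition el :: "'k::comm_ring_1 \<Rightarrow> nat \<Rightarrow> 'k abt \<Rightarrow> 'k endos" where
  "el \<delta> r t = abs_endos (\<lambda>\<delta>' r'. if \<delta>' = \<delta> \<and> r' = r then t else Zr r' r')"

lemma abs_endos_eq_iff: "famrel f f \<Longrightarrow> famrel g g \<Longrightarrow> abs_endos f = abs_endos g \<longleftrightarrow> famrel f g"
  using Quotient_rel[OF Quotient_endos, of f g] by blast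

lemma famrel_el: "famrel (\<lambda>\<delta>' r'. if \<delta>' = \<delta> \<and> r' = r then s else Zr r' r')
    (\<lambda>\<delta>' r'. if \<delta>' = \<delta> \<and> r' = r then t else Zr r' r') \<longleftrightarrow> endo r s \<and> endo r t \<and> abeq \<delta> s t"
proof -
  have "abeq \<delta>' (Zr r' r') (Zr r' r')" for \<delta>' :: 'a and r' by (rule abeq.refl) simp
  then show ?thesis unfolding famrel_def by (auto split: if_splits)
qed

text \<open>The bridge used in both directions: defining relations enter the ring as equations, and
  the resulting ring identities are read back as equalities of morphisms.\<close>

lemma el_eq_iff: "endo r s \<Longrightarrow> endo r t \<Longrightarrow> el \<delta> r s = el \<delta> r t \<longleftrightarrow> abeq \<delta> s t"
  unfolding el_def by (subst abs_endos_eq_iff) (auto simp: famrel_el intro: abeq.refl)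

lemma el_Zr:
  fixes \<delta> :: "'a::comm_ring_1"
  shows "el \<delta> r (Zr r r) = 0"
proof -
  have "(\<lambda>\<delta>' r'. if \<delta>' = \<delta> \<and> r' = r then Zr r r :: 'a abt else Zr r' r') = (\<lambda>_ r'. Zr r' r')"
    by (auto simp: fun_eq_iff)
  then show ?thesis unfolding el_def zero_endos_def by simp
qed

lemma el_Pls:
  assumes "endo r s" "endo r t"
  shows "el \<delta> r (Pls s t) = el \<delta> r s + el \<delta> r t"
proof -
  have "famrel (\<lambda>\<delta>' r'. if \<delta>' = \<delta> \<and> r' = r then Pls s t else Zr r' r')
     (\<lambda>\<delta>' r'. Pls (if \<delta>' = \<delta> \<and> r' = r then s else Zr r' r') (if \<delta>' = \<delta> \<and> r' = r then t else Zr r' r'))"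
    unfolding famrel_def using assms abeq.sym[OF Zr_idem] abeq.refl[of "Pls s t"] by auto
  then show ?thesis using assms abeq.refl[of s] abeq.refl[of t] unfolding el_def
    by (subst plus_endos.abs_eq) (auto simp: famrel_el intro!: Quotient_rel_abs[OF Quotient_endos])
qed

lemma el_Cmp:
  assumes "endo r s" "endo r t"
  shows "el \<delta> r (Cmp s t) = el \<delta> r s * el \<delta> r t"
proof -
  have "abeq \<delta>' (Zr r' r') (Cmp (Zr r' r') (Zr r' r'))" for \<delta>' :: 'a and r'
    using abeq.sym[OF Cmp_Zr[of "Zr r' r'" r' \<delta>' r']] by simp
  then have "famrel (\<lambda>\<delta>' r'. if \<delta>' = \<delta> \<and> r' = r then Cmp s t else Zr r' r')
     (\<lambda>\<delta>' r'. Cmp (if \<delta>' = \<delta> \<and> r' = r then s else Zr r' r') (if \<delta>' = \<delta> \<and> r' = r then t else Zr r' r'))"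
    unfolding famrel_def using assms abeq.refl[of "Cmp s t"] by auto
  then show ?thesis using assms abeq.refl[of s] abeq.refl[of t] unfolding el_def
    by (subst times_endos.abs_eq) (auto simp: famrel_el intro!: Quotient_rel_abs[OF Quotient_endos])
qed

lemma el_neg: "endo r t \<Longrightarrow> el \<delta> r (Scl (-1) t) = - el \<delta> r t"
  using el_Pls[of t r "Scl (-1) t" \<delta>] el_eq_iff[of "Pls t (Scl (-1) t)" r "Zr r r" \<delta>] abeq.pls_neg[of t \<delta>] el_Zr[of \<delta> r]
  by (simp add: add_eq_0_iff)

lemma el_tminus: "endo r s \<Longrightarrow> endo r t \<Longrightarrow> el \<delta> r (tminus s t) = el \<delta> r s - el \<delta> r t"
  by (simp add: tminus_def el_Pls el_neg)

section \<open>Tensor products and the pole\<close>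

lemma dtens_sel [simp]: "ddom (dtens A B) = ddom A + ddom B" "dcod (dtens A B) = dcod A + dcod B"
  by (auto simp: dtens_def ddom_def dcod_def)

lemma dmap_dtens [simp]:
  "dmap (dtens A B) (Bt i) = (if i < ddom A then dmap A (Bt i) else shf A (dmap B (Bt (i - ddom A))))"
  "dmap (dtens A B) (Tp i) = (if i < dcod A then dmap A (Tp i) else shf A (dmap B (Tp (i - dcod A))))"
  by (auto simp: dtens_def dmap_def[of "(_, _, _)"])

lemma shf_simps [simp]: "shf A (Bt i) = Bt (i + ddom A)" "shf A (Tp i) = Tp (i + dcod A)"
  by (auto simp: shf_def)

lemma valid_dtens [simp]:
  assumes A: "valid_diag A" and B: "valid_diag B"
  shows "valid_diag (dtens A B)"
proof (rule valid_diagI)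
  fix i assume "i < ddom (dtens A B)"
  then show "dmap (dtens A B) (Bt i) \<in> pts (ddom (dtens A B)) (dcod (dtens A B)) \<and>
     dmap (dtens A B) (Bt i) \<noteq> Bt i \<and> dmap (dtens A B) (dmap (dtens A B) (Bt i)) = Bt i"
    using valid_dmap[OF A, of "Bt i"] valid_dmap[OF B, of "Bt (i - ddom A)"]
    by (cases "i < ddom A"; cases "dmap A (Bt i)"; cases "dmap B (Bt (i - ddom A))") auto
next
  fix i assume "i < dcod (dtens A B)"
  then show "dmap (dtens A B) (Tp i) \<in> pts (ddom (dtens A B)) (dcod (dtens A B)) \<and>
     dmap (dtens A B) (Tp i) \<noteq> Tp i \<and> dmap (dtens A B) (dmap (dtens A B) (Tp i)) = Tp i"
    using valid_dmap[OF A, of "Tp i"] valid_dmap[OF B, of "Tp (i - dcod A)"]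
    by (cases "i < dcod A"; cases "dmap A (Tp i)"; cases "dmap B (Tp (i - dcod A))") auto
qed (auto simp: valid_dmap_out[OF B])

lemma dtens_idd_idd [simp]: "dtens (idd a) (idd b) = idd (a + b)"
  by (rule diag_eqI2) auto

text \<open>Brings a permutation that fixes the first strand into the only form that the relations
  for \<open>PoleH\<close> can move: an identity strand with a diagram to its right.\<close>

lemma dtens_idd_permd:
  assumes "pbij (Suc m) \<rho>" "\<rho> 0 = 0"
  obtains D where "valid_diag D" "ddom D = m" "dcod D = m" "permd (Suc m) \<rho> = dtens (idd 1) D"
proof -
  \<comment> \<open>The truncated subtraction is harmless: by injectivity only the first strand is
    sent to \<open>0\<close>.\<close>
  define \<rho>' where "\<rho>' = (\<lambda>i. \<rho> (Suc i) - 1)"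
  have pos: "\<rho> (Suc i) > 0" if "i < m" for i
    using pbij_eq_iff[OF assms(1), of "Suc i" 0] assms(2) that by simp
  have "pbij m \<rho>'"
    unfolding pbij_def bij_betw_def
  proof
    show inj: "inj_on \<rho>' {..<m}"
    proof (rule inj_onI)
      fix i j assume ij: "i \<in> {..<m}" "j \<in> {..<m}" "\<rho>' i = \<rho>' j"
      then have "\<rho> (Suc i) = \<rho> (Suc j)" using pos[of i] pos[of j] unfolding \<rho>'_def by auto
      then show "i = j" using pbij_eq_iff[OF assms(1), of "Suc i" "Suc j"] ij by simp
    qed
    have "\<rho>' ` {..<m} \<subseteq> {..<m}"
      using pbij_less[OF assms(1)] pos unfolding \<rho>'_def by fastforce
    then show "\<rho>' ` {..<m} = {..<m}" using inj by (simp add: endo_inj_surj)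
  qed
  moreover from this have "permd (Suc m) \<rho> = dtens (idd 1) (permd m \<rho>')"
  proof (intro permd_eqI[symmetric])
    show "dmap (dtens (idd 1) (permd m \<rho>')) (Bt i) = Tp (\<rho> i)" if "i < Suc m" for i
      using that pos[of "i - 1"] assms(2) by (cases i) (auto simp: \<rho>'_def)
  qed (use assms in auto)
  ultimately show ?thesis by (intro that[of "permd m \<rho>'"]) auto
qed

lemma dtens_idd_ed: "dtens (idd 1) (ed m i j) = ed (Suc m) (Suc i) (Suc j)"
  by (rule diag_eqI2) (auto simp: less_Suc_eq_0_disj)

lemma dtens_ed_idd: "dtens (ed 2 0 1) (idd m) = ed (m + 2) 0 1"
  by (rule diag_eqI2) auto

lemma dtens_crossX_idd: "dtens crossX (idd m) = permd (m + 2) (tr 0 1)"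
  unfolding crossX_def by (rule permd_eqI) (auto simp: pbij_tr tr_def)

lemma valid_crossX [simp]: "valid_diag crossX" and crossX_sel [simp]: "ddom crossX = 2" "dcod crossX = 2"
  by (auto simp: crossX_def pbij_tr)

lemma dmap_crossX [simp]: "dmap crossX (Bt 0) = Tp (Suc 0)" "dmap crossX (Bt (Suc 0)) = Tp 0"
   "dmap crossX (Tp 0) = Bt (Suc 0)" "dmap crossX (Tp (Suc 0)) = Bt 0"
  by (auto simp: crossX_def inv_tr)

lemma capd_sel [simp]: "ddom capd = 2" "dcod capd = 0"
  and cupd_sel [simp]: "ddom cupd = 0" "dcod cupd = 2"
  by (auto simp: capd_def cupd_def ddom_def dcod_def)

lemma dmap_capd [simp]: "dmap capd p = (if p = Bt 0 then Bt 1 else if p = Bt 1 then Bt 0 else p)"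
  and dmap_cupd [simp]: "dmap cupd p = (if p = Tp 0 then Tp 1 else if p = Tp 1 then Tp 0 else p)"
  by (auto simp: capd_def cupd_def dmap_def)

lemma valid_capd [simp]: "valid_diag capd" and valid_cupd [simp]: "valid_diag cupd"
  by (rule valid_diagI; auto)+

lemma dcomp_cup_cap: "dcomp cupd capd = ed 2 0 1"
  by (rule dcomp_eqI[where n = 1]) auto

lemma loops_cup_cap: "loops cupd capd = 0"
  by (rule loops_eq_0I) auto

lemma wt_iota [simp]: "wt (iota D) \<longleftrightarrow> valid_diag D" "tdom (iota D) = ddom D" "tcod (iota D) = dcod D"
  by (auto simp: iota_def)

lemma wt_IIr [simp]: "wt (IIr r)" "tdom (IIr r) = r" "tcod (IIr r) = r"
  by (auto simp: IIr_def)

lemma wt_tminus [simp]: "wt (tminus s t) \<longleftrightarrow> wt s \<and> wt t \<and> tdom s = tdom t \<and> tcod s = tcod t"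
   "tdom (tminus s t) = tdom s" "tcod (tminus s t) = tcod s"
  by (auto simp: tminus_def)

text \<open>Every composition rule carries a power of \<delta> counting loops; this removes it from
  loop-free composites.\<close>

lemma abeq_Scl_loops0: "abeq \<delta> s (Scl (\<delta> ^ n) t) \<Longrightarrow> n = 0 \<Longrightarrow> wt t \<Longrightarrow> abeq \<delta> s t"
  using abeq.trans[OF _ abeq.scl_one] by simp

lemma iota_comp:
  assumes "valid_diag A" "valid_diag B" "dcod A = ddom B" "dcomp B A = C" "loops B A = 0" "valid_diag C"
  shows "abeq \<delta> (Cmp (iota B) (iota A)) (iota C)"
  unfolding iota_def
proof (rule abeq_Scl_loops0)
  show "abeq \<delta> (Cmp (Tns PoleI B) (Tns PoleI A)) (Scl (\<delta> ^ loops B A) (Tns PoleI C))"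
    using abeq.rel_I[OF assms(2,1,3), of \<delta>] by (simp only: assms(4))
qed (use assms in auto)

lemma Tns_iota: "valid_diag B \<Longrightarrow> valid_diag C \<Longrightarrow> abeq \<delta> (Tns (iota B) C) (iota (dtens B C))"
  unfolding iota_def by (rule abeq.tns_tns) auto

lemma Tns_Cmp:
  assumes "wt (Cmp d e)"
  shows "abeq \<delta> (Tns (Cmp d e) (idd n)) (Cmp (Tns d (idd n)) (Tns e (idd n)))"
proof (rule abeq.sym, rule abeq_Scl_loops0)
  show "abeq \<delta> (Cmp (Tns d (idd n)) (Tns e (idd n)))
     (Scl (\<delta> ^ loops (idd n) (idd n)) (Tns (Cmp d e) (idd n)))"
    using abeq.interchange[OF assms, of "idd n" "idd n" \<delta>] dcomp_idd_left[of "idd n"] by simp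
qed (use assms loops_idd_left[of "idd n"] in auto)

lemma slide_below:
  assumes "valid_diag D"
  shows "abeq \<delta> (Cmp (Tns PoleH (idd (dcod D))) (iota (dtens (idd 1) D))) (Tns PoleH D)"
proof -
  have "abeq \<delta> (Cmp (Tns PoleH (idd (dcod D))) (iota (dtens (idd 1) D)))
      (Cmp (Tns PoleH (idd (dcod D))) (Tns (IIr 1) D))"
    unfolding IIr_def using assms by (intro cmpR abeq.sym[OF Tns_iota]) auto
  also have "abeq \<delta> \<dots> (Tns PoleH D)"
  proof (rule abeq_Scl_loops0)
    show "abeq \<delta> (Cmp (Tns PoleH (idd (dcod D))) (Tns (IIr 1) D)) (Scl (\<delta> ^ loops (idd (dcod D)) D) (Tns PoleH D))"
      using abeq.rel_H1[of "idd (dcod D)" D \<delta>] assms dcomp_idd_left[OF assms] by simp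
  qed (use assms loops_idd_left[OF assms] in auto)
  finally show ?thesis .
qed

lemma slide_above:
  assumes "valid_diag D"
  shows "abeq \<delta> (Cmp (iota (dtens (idd 1) D)) (Tns PoleH (idd (ddom D)))) (Tns PoleH D)"
proof -
  have "abeq \<delta> (Cmp (iota (dtens (idd 1) D)) (Tns PoleH (idd (ddom D))))
      (Cmp (Tns (IIr 1) D) (Tns PoleH (idd (ddom D))))"
    unfolding IIr_def using assms by (intro cmpL abeq.sym[OF Tns_iota]) auto
  also have "abeq \<delta> \<dots> (Tns PoleH D)"
  proof (rule abeq_Scl_loops0)
    show "abeq \<delta> (Cmp (Tns (IIr 1) D) (Tns PoleH (idd (ddom D)))) (Scl (\<delta> ^ loops D (idd (ddom D))) (Tns PoleH D))"
      using abeq.rel_H2[of D "idd (ddom D)" \<delta>] assms dcomp_idd_right[OF assms] by simp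
  qed (use assms loops_idd_right[OF assms] in auto)
  finally show ?thesis .
qed

text \<open>The connector touches only the first strand, so both composites equal
  \<open>Tns PoleH D\<close>. The number of strands may change along \<open>D\<close>, which is what
  \<open>down\<close> and \<open>up\<close> need.\<close>

lemma slide: "valid_diag D \<Longrightarrow> abeq \<delta> (Cmp (Tns PoleH (idd (dcod D))) (iota (dtens (idd 1) D)))
    (Cmp (iota (dtens (idd 1) D)) (Tns PoleH (idd (ddom D))))"
  by (rule abeq.trans[OF slide_below abeq.sym[OF slide_above]])

section \<open>Permutations, arcs and connectors as ring elements\<close>

definition perm_el :: "'k::comm_ring_1 \<Rightarrow> nat \<Rightarrow> (nat \<Rightarrow> nat) \<Rightarrow> 'k endos" where
  "perm_el \<delta> r \<pi> = el \<delta> r (iota (permd r \<pi>))"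
definition e_el :: "'k::comm_ring_1 \<Rightarrow> nat \<Rightarrow> nat \<Rightarrow> nat \<Rightarrow> 'k endos" where
  "e_el \<delta> r i j = el \<delta> r (iota (ed r i j))"
definition pole_el :: "'k::comm_ring_1 \<Rightarrow> nat \<Rightarrow> 'k endos" where
  "pole_el \<delta> r = el \<delta> r (Tns PoleH (idd (r - 1)))"
definition h_el :: "'k::comm_ring_1 \<Rightarrow> nat \<Rightarrow> nat \<Rightarrow> 'k endos" where
  "h_el \<delta> r i = el \<delta> r (HH0 r (Suc i))"

lemma el_iota_mult:
  assumes "valid_diag A" "valid_diag B" "valid_diag C" "dcomp B A = C" "loops B A = 0"
    and "ddom A = r" "dcod A = r" "ddom B = r" "dcod B = r"
  shows "el \<delta> r (iota B) * el \<delta> r (iota A) = el \<delta> r (iota C)"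
proof -
  have "ddom C = r" "dcod C = r" using assms by auto
  then show ?thesis using iota_comp[OF assms(1,2) _ assms(4,5,3), of \<delta>] assms
    by (subst el_Cmp[symmetric]) (auto simp: el_eq_iff)
qed

lemma perm_el_mult: "pbij r \<pi> \<Longrightarrow> pbij r \<rho> \<Longrightarrow> perm_el \<delta> r \<pi> * perm_el \<delta> r \<rho> = perm_el \<delta> r (\<pi> \<circ> \<rho>)"
  unfolding perm_el_def by (rule el_iota_mult) (auto simp: dcomp_permd loops_permd_left pbij_comp)

lemma perm_el_cong: "(\<And>i. i < r \<Longrightarrow> \<pi> i = \<rho> i) \<Longrightarrow> perm_el \<delta> r \<pi> = perm_el \<delta> r \<rho>"
  unfolding perm_el_def using permd_cong[of r \<pi> \<rho>] by simp

lemma perm_el_id_left: "endo r t \<Longrightarrow> perm_el \<delta> r id * el \<delta> r t = el \<delta> r t"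
  unfolding perm_el_def idd_permd[symmetric] IIr_def[symmetric]
  using abeq.id_left[of t \<delta>] by (subst el_Cmp[symmetric]) (auto simp: el_eq_iff)

lemma perm_el_id_right: "endo r t \<Longrightarrow> el \<delta> r t * perm_el \<delta> r id = el \<delta> r t"
  unfolding perm_el_def idd_permd[symmetric] IIr_def[symmetric]
  using abeq.id_right[of t \<delta>] by (subst el_Cmp[symmetric]) (auto simp: el_eq_iff)

lemma perm_el_inv:
  assumes "pbij r \<pi>"
  shows "perm_el \<delta> r \<pi> * perm_el \<delta> r (inv_into {..<r} \<pi>) = perm_el \<delta> r id" "perm_el \<delta> r (inv_into {..<r} \<pi>) * perm_el \<delta> r \<pi> = perm_el \<delta> r id"
  using assms by (auto simp: perm_el_mult pbij_inv_into intro!: perm_el_cong)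

lemma perm_el_e_el:
  assumes "pbij r \<pi>" "i < r" "j < r" "i \<noteq> j"
  shows "perm_el \<delta> r \<pi> * e_el \<delta> r i j = e_el \<delta> r (\<pi> i) (\<pi> j) * perm_el \<delta> r \<pi>"
proof -
  have "perm_el \<delta> r \<pi> * e_el \<delta> r i j = el \<delta> r (iota (ped r \<pi> i j))"
    unfolding perm_el_def e_el_def using assms
    by (intro el_iota_mult) (auto simp: dcomp_permd_ed loops_permd_left)
  also have "\<dots> = e_el \<delta> r (\<pi> i) (\<pi> j) * perm_el \<delta> r \<pi>"
    unfolding perm_el_def e_el_def using assms
    by (intro el_iota_mult[symmetric]) (auto simp: dcomp_ed_permd loops_permd_right pbij_eq_iff pbij_less)
  finally show ?thesis .
qed

lemma e_el_commute: "e_el \<delta> r i j = e_el \<delta> r j i"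
  by (simp add: e_el_def ed_commute)

lemma perm_el_tr_commute: "perm_el \<delta> r (tr i j) = perm_el \<delta> r (tr j i)"
  by (rule perm_el_cong) (auto simp: tr_def)

lemma perm_el_tr_e_el:
  assumes "i < r" "j < r" "i \<noteq> j"
  shows "perm_el \<delta> r (tr i j) * e_el \<delta> r i j = e_el \<delta> r i j" "e_el \<delta> r i j * perm_el \<delta> r (tr i j) = e_el \<delta> r i j"
proof -
  show 1: "perm_el \<delta> r (tr i j) * e_el \<delta> r i j = e_el \<delta> r i j"
    unfolding perm_el_def e_el_def using assms
    by (intro el_iota_mult) (auto simp: dcomp_permd_ed loops_permd_left pbij_tr ped_tr)
  show "e_el \<delta> r i j * perm_el \<delta> r (tr i j) = e_el \<delta> r i j"
    using perm_el_e_el[OF pbij_tr[OF assms(1,2)] assms, of \<delta>] 1 by (simp add: e_el_commute)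
qed

lemma perm_el_tr_tr: "i < r \<Longrightarrow> j < r \<Longrightarrow> perm_el \<delta> r (tr i j) * perm_el \<delta> r (tr i j) = perm_el \<delta> r id"
  by (simp add: perm_el_mult pbij_tr o_def) (rule perm_el_cong, simp)

text \<open>Both sides are the diagram with bottom arc \<open>j\<close>, \<open>k\<close>, top arc
  \<open>i\<close>, \<open>j\<close> and a strand from \<open>i\<close> to \<open>k\<close>. Trading
  an arc for a transposition is what later makes \<open>e_ij\<close> annihilate
  \<open>H_ik + H_jk\<close>.\<close>

lemma e_el_adjacent:
  assumes "i < r" "j < r" "k < r" "distinct [i, j, k]"
  shows "e_el \<delta> r i j * e_el \<delta> r j k = e_el \<delta> r i j * perm_el \<delta> r (tr i k)"
proof -
  have "e_el \<delta> r i j * e_el \<delta> r j k = el \<delta> r (iota (ped r (tr i k) k j))"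
    unfolding e_el_def using assms
    by (intro el_iota_mult) (auto simp: dcomp_ed_adjacent loops_ed_adjacent pbij_tr)
  also have "\<dots> = e_el \<delta> r (tr i k k) (tr i k j) * perm_el \<delta> r (tr i k)"
    unfolding perm_el_def e_el_def using assms
    by (intro el_iota_mult[symmetric] dcomp_ed_permd loops_permd_right valid_ed) (auto simp: pbij_tr)
  finally show ?thesis using assms by simp
qed

lemma e_el_disjoint:
  assumes "i < r" "j < r" "k < r" "l < r" "distinct [i, j, k, l]"
  shows "e_el \<delta> r i j * e_el \<delta> r k l = e_el \<delta> r k l * e_el \<delta> r i j"
proof -
  have v: "valid_diag (eed r i j k l)" by (rule valid_diagI) (use assms in auto)
  have "e_el \<delta> r i j * e_el \<delta> r k l = el \<delta> r (iota (eed r i j k l))"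
    unfolding e_el_def using assms v
    by (intro el_iota_mult) (auto simp: dcomp_ed_disjoint loops_ed_disjoint)
  also have "\<dots> = e_el \<delta> r k l * e_el \<delta> r i j"
    unfolding e_el_def using assms v
    by (intro el_iota_mult[symmetric]) (auto simp: dcomp_ed_disjoint loops_ed_disjoint eed_commute[of i j k l])
  finally show ?thesis .
qed

text \<open>The one composite in which a loop closes. The ring has no scalar action, so \<delta> has
  to stay inside \<open>el\<close>.\<close>

lemma e_el_self:
  assumes "i < r" "j < r" "i \<noteq> j"
  shows "e_el \<delta> r i j * e_el \<delta> r i j = el \<delta> r (Scl \<delta> (iota (ed r i j)))"
  unfolding e_el_def using assms abeq.rel_I[of "ed r i j" "ed r i j" \<delta>]
  by (subst el_Cmp[symmetric]) (auto simp: el_eq_iff iota_def dcomp_ed_self loops_ed_self)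

lemma pole_slide:
  assumes "valid_diag D" "ddom D = r - 1" "dcod D = r - 1" "r \<ge> 1"
  shows "pole_el \<delta> r * el \<delta> r (iota (dtens (idd 1) D)) = el \<delta> r (iota (dtens (idd 1) D)) * pole_el \<delta> r"
  unfolding pole_el_def using assms slide[OF assms(1), of \<delta>]
  by (auto simp: el_eq_iff el_Cmp[symmetric])

lemma perm_el_pole:
  assumes "pbij r \<pi>" "\<pi> 0 = 0" "r \<ge> 1"
  shows "perm_el \<delta> r \<pi> * pole_el \<delta> r = pole_el \<delta> r * perm_el \<delta> r \<pi>"
proof -
  have "Suc (r - 1) = r" using assms by simp
  then obtain D where D: "valid_diag D" "ddom D = r - 1" "dcod D = r - 1" "permd r \<pi> = dtens (idd 1) D"
    using dtens_idd_permd[of "r - 1" \<pi>] assms by metis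
  show ?thesis unfolding perm_el_def D(4) using D assms by (intro pole_slide[symmetric]) auto
qed

lemma e_el_pole:
  assumes "0 < i" "i < r" "0 < j" "j < r" "i \<noteq> j"
  shows "e_el \<delta> r i j * pole_el \<delta> r = pole_el \<delta> r * e_el \<delta> r i j"
proof -
  have "ed r i j = dtens (idd 1) (ed (r - 1) (i - 1) (j - 1))"
    using assms by (simp only: dtens_idd_ed) simp
  then show ?thesis unfolding e_el_def using assms by (simp only:) (intro pole_slide[symmetric], auto)
qed

lemma pbij_sigmap: "i < r \<Longrightarrow> pbij r (sigmap (Suc i))"
  unfolding pbij_def
  by (rule bij_betw_byWitness[where f' = "\<lambda>b. if b = 0 then i else if b \<le> i then b - 1 else b"])
     (auto simp: sigmap_def)

lemma valid_sigma [simp]: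
  "i < r \<Longrightarrow> valid_diag (sigmad r (Suc i))" "i < r \<Longrightarrow> valid_diag (sigmainvd r (Suc i))"
  "ddom (sigmad r i) = r" "dcod (sigmad r i) = r" "ddom (sigmainvd r i) = r" "dcod (sigmainvd r i) = r"
  by (auto simp: sigmad_def sigmainvd_def pbij_sigmap pbij_inv_into)

lemma endo_HH0 [simp]: "i < r \<Longrightarrow> wt (HH0 r (Suc i))" "tdom (HH0 r i) = r" "tcod (HH0 r i) = r"
  by (auto simp: HH0_def)

lemma h_el_sigma: "i < r \<Longrightarrow> h_el \<delta> r i = perm_el \<delta> r (inv_into {..<r} (sigmap (Suc i))) * (pole_el \<delta> r * perm_el \<delta> r (sigmap (Suc i)))"
  unfolding h_el_def HH0_def perm_el_def pole_el_def
  by (simp add: el_Cmp sigmad_def[symmetric] sigmainvd_def[symmetric])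

text \<open>\<open>h_el \<delta> r i\<close> is transported by any permutation, because two permutations sending \<open>i\<close> to
 the strand at the pole differ by one that fixes this strand and hence slides past \<open>pole_el\<close>.\<close>

lemma perm_el_h_el:
  assumes "pbij r \<pi>" "i < r"
  shows "perm_el \<delta> r \<pi> * h_el \<delta> r i = h_el \<delta> r (\<pi> i) * perm_el \<delta> r \<pi>"
proof -
  let ?inv = "inv_into {..<r}"
  define s t where "s = sigmap (Suc i)" and "t = sigmap (Suc (\<pi> i))"
  have st: "pbij r s" "pbij r t" "s i = 0" "t (\<pi> i) = 0"
    using assms by (auto simp: s_def t_def pbij_sigmap pbij_less) (auto simp: sigmap_def)
  have "?inv s 0 = i" using pbij_inv[OF st(1) assms(2)] st(3) by simp
  define u where "u = t \<circ> \<pi> \<circ> ?inv s"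
  have u: "pbij r u" "u 0 = 0"
    using assms st \<open>?inv s 0 = i\<close> by (auto simp: u_def pbij_comp pbij_inv_into)
  have 1: "perm_el \<delta> r \<pi> * perm_el \<delta> r (?inv s) = perm_el \<delta> r (?inv t) * perm_el \<delta> r u"
    using assms st u by (auto simp: perm_el_mult pbij_inv_into u_def pbij_less intro!: perm_el_cong)
  have 2: "perm_el \<delta> r u * perm_el \<delta> r s = perm_el \<delta> r t * perm_el \<delta> r \<pi>"
    using assms st u by (auto simp: perm_el_mult pbij_inv_into u_def pbij_less intro!: perm_el_cong)
  have 3: "perm_el \<delta> r u * pole_el \<delta> r = pole_el \<delta> r * perm_el \<delta> r u"
    using perm_el_pole[OF u] assms(2) by simp
  have "perm_el \<delta> r \<pi> * h_el \<delta> r i = (perm_el \<delta> r \<pi> * perm_el \<delta> r (?inv s)) * (pole_el \<delta> r * perm_el \<delta> r s)"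
    using assms by (simp only: h_el_sigma s_def mult.assoc)
  also have "\<dots> = perm_el \<delta> r (?inv t) * (perm_el \<delta> r u * pole_el \<delta> r) * perm_el \<delta> r s"
    by (simp only: 1 mult.assoc)
  also have "\<dots> = perm_el \<delta> r (?inv t) * pole_el \<delta> r * (perm_el \<delta> r u * perm_el \<delta> r s)"
    by (simp only: 3 mult.assoc)
  also have "\<dots> = h_el \<delta> r (\<pi> i) * perm_el \<delta> r \<pi>"
    using assms by (simp only: 2 h_el_sigma pbij_less t_def mult.assoc)
  finally show ?thesis .
qed

lemma h_el_0:
  assumes "r \<ge> 1"
  shows "h_el \<delta> r 0 = pole_el \<delta> r"
proof -
  have "perm_el \<delta> r (sigmap (Suc 0)) = perm_el \<delta> r id" "perm_el \<delta> r (inv_into {..<r} (sigmap (Suc 0))) = perm_el \<delta> r id"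
    using assms pbij_inv_eq_iff[OF pbij_sigmap[of 0 r]] by (auto intro!: perm_el_cong simp: sigmap_def)
  then show ?thesis using assms by (simp add: h_el_sigma pole_el_def perm_el_id_left perm_el_id_right)
qed

text \<open>The transposition of \<open>0\<close> and \<open>i\<close> carries the connector to the
  first strand. As \<open>k\<close> and \<open>l\<close> differ from \<open>i\<close>, their images
  avoid \<open>0\<close>, and the arc slides past the pole.\<close>

lemma e_el_h_el:
  assumes "i < r" "k < r" "l < r" "distinct [i, k, l]"
  shows "e_el \<delta> r k l * h_el \<delta> r i = h_el \<delta> r i * e_el \<delta> r k l"
proof -
  let ?t = "tr 0 i"
  have t: "pbij r ?t" using assms by (intro pbij_tr) auto
  have h: "h_el \<delta> r i * perm_el \<delta> r ?t = perm_el \<delta> r ?t * pole_el \<delta> r"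
    using perm_el_h_el[OF t, of 0 \<delta>] assms h_el_0[of r \<delta>] by simp
  have kl: "0 < ?t k" "?t k < r" "0 < ?t l" "?t l < r" "?t k \<noteq> ?t l"
    using assms pbij_less[OF t] pbij_eq_iff[OF t, of k l] by (auto simp: tr_def)
  have e: "e_el \<delta> r k l * perm_el \<delta> r ?t = perm_el \<delta> r ?t * e_el \<delta> r (?t k) (?t l)"
    using perm_el_e_el[OF t kl(2,4,5), of \<delta>] by simp
  have "e_el \<delta> r k l * h_el \<delta> r i * perm_el \<delta> r ?t = h_el \<delta> r i * e_el \<delta> r k l * perm_el \<delta> r ?t"
  proof -
    have "e_el \<delta> r k l * h_el \<delta> r i * perm_el \<delta> r ?t = (e_el \<delta> r k l * perm_el \<delta> r ?t) * pole_el \<delta> r"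
      by (simp only: h mult.assoc)
    also have "\<dots> = (perm_el \<delta> r ?t * pole_el \<delta> r) * e_el \<delta> r (?t k) (?t l)"
      by (simp only: e e_el_pole[OF kl] mult.assoc)
    also have "\<dots> = h_el \<delta> r i * e_el \<delta> r k l * perm_el \<delta> r ?t"
      by (simp only: h[symmetric] e mult.assoc)
    finally show ?thesis .
  qed
  \<comment> \<open>A second factor \<open>?t\<close> produces the square of a transposition,
    \<open>perm_el \<delta> r id\<close>, which is a right unit for both products.\<close>
  then have "e_el \<delta> r k l * h_el \<delta> r i * perm_el \<delta> r ?t * perm_el \<delta> r ?t = h_el \<delta> r i * e_el \<delta> r k l * perm_el \<delta> r ?t * perm_el \<delta> r ?t"
    by simp
  moreover have "x * perm_el \<delta> r ?t * perm_el \<delta> r ?t = x * perm_el \<delta> r id" for x :: "'a endos"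
    using perm_el_tr_tr[of 0 r i \<delta>] assms by (simp add: mult.assoc)
  ultimately show ?thesis using assms
    by (simp add: h_el_def e_el_def mult.assoc perm_el_id_right)
qed

section \<open>Skew symmetry and the four-term relation\<close>

definition arcs :: "nat \<Rightarrow> nat \<Rightarrow> (pt \<times> pt) list \<Rightarrow> diag" where
  "arcs n m ps = (n, m, \<lambda>p. case map_of (ps @ map prod.swap ps) p of None \<Rightarrow> p | Some q \<Rightarrow> q)"

lemma arcs_sel [simp]: "ddom (arcs n m ps) = n" "dcod (arcs n m ps) = m"
  "dmap (arcs n m ps) p = (case map_of (ps @ map prod.swap ps) p of None \<Rightarrow> p | Some q \<Rightarrow> q)"
  by (auto simp: arcs_def ddom_def dcod_def dmap_def)

abbreviation (input) "cap1 \<equiv> dtens (dtens capd (idd 1)) (idd 1)"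
abbreviation (input) "cup1 \<equiv> dtens (dtens cupd (idd 1)) (idd 1)"
abbreviation (input) "X1 \<equiv> dtens crossX (idd 1)"

text \<open>Counting from 0, \<open>capsB\<close> has the arcs \<open>0\<close>, \<open>2\<close>
  and \<open>1\<close>, \<open>3\<close>. With a strand added on its left, \<open>down\<close>
  supplies the second of these, which avoids the strand of the connector. \<open>up\<close> and the
  cups are the reflections.\<close>

definition "down = arcs 3 1 [(Bt 0, Bt 2), (Bt 1, Tp 0)]"
definition "up = arcs 1 3 [(Tp 0, Tp 2), (Tp 1, Bt 0)]"
definition "capsA = arcs 4 0 [(Bt 0, Bt 1), (Bt 2, Bt 3)]"
definition "capsB = arcs 4 0 [(Bt 0, Bt 2), (Bt 1, Bt 3)]"
definition "cupsA = arcs 0 4 [(Tp 0, Tp 1), (Tp 2, Tp 3)]"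
definition "cupsB = arcs 0 4 [(Tp 0, Tp 2), (Tp 1, Tp 3)]"

lemmas arcs_defs = down_def up_def capsA_def capsB_def cupsA_def cupsB_def

lemma less_numeral_cases: "i < (4::nat) \<longleftrightarrow> i = 0 \<or> i = Suc 0 \<or> i = 2 \<or> i = 3"
  "i < (3::nat) \<longleftrightarrow> i = 0 \<or> i = Suc 0 \<or> i = 2" "i < (2::nat) \<longleftrightarrow> i = 0 \<or> i = Suc 0"
  by auto

lemma arcs_defs_sel [simp]:
  "ddom down = 3" "dcod down = 1" "ddom up = 1" "dcod up = 3"
  "ddom capsA = 4" "dcod capsA = 0" "ddom capsB = 4" "dcod capsB = 0"
  "ddom cupsA = 0" "dcod cupsA = 4" "ddom cupsB = 0" "dcod cupsB = 4"
  by (simp_all add: arcs_defs)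

lemma valid_arcs [simp]: "valid_diag down" "valid_diag up" "valid_diag capsA" "valid_diag capsB"
  "valid_diag cupsA" "valid_diag cupsB"
  by (rule valid_diagI; auto simp: arcs_defs less_numeral_cases)+

lemma dmap_crossX_Tp_1 [simp]: "dmap crossX (Tp 1) = Bt 0"
  by simp

lemmas dmap_arcs = arcs_defs[THEN arg_cong, where f = dmap]

lemma dcomp_arcs:
  "dcomp capd cap1 = capsA"
  "dcomp capsA (dtens (idd 1) X1) = capsB"
  "dcomp capd (dtens (idd 1) down) = capsB"
  "dcomp (dtens (idd 1) down) cup1 = crossX"
  "dcomp cup1 cupd = cupsA"
  "dcomp (dtens (idd 1) X1) cupsA = cupsB"
  "dcomp (dtens (idd 1) up) cupd = cupsB"
  "dcomp cap1 (dtens (idd 1) up) = crossX"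
  by (rule dcomp_eqI[where n = 5]; auto simp: dmap_arcs less_numeral_cases eval_nat_numeral less_Suc_eq)+

lemma loops_arcs:
  "loops capd cap1 = 0"
  "loops capsA (dtens (idd 1) X1) = 0"
  "loops capd (dtens (idd 1) down) = 0"
  "loops (dtens (idd 1) down) cup1 = 0"
  "loops cup1 cupd = 0"
  "loops (dtens (idd 1) X1) cupsA = 0"
  "loops (dtens (idd 1) up) cupd = 0"
  "loops cap1 (dtens (idd 1) up) = 0"
  by (rule loops_eq_0I[where n = 5]; auto simp: dmap_arcs less_numeral_cases eval_nat_numeral less_Suc_eq)+


lemma skew_tensor:
  fixes \<delta> :: "'k::comm_ring_1"
  shows "abeq \<delta> (Cmp (iota cap1) (Cmp (Tns PoleH X1) (iota cup1))) (Scl (-1) (Tns PoleH (idd 1)))"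
proof -
  let ?a = "iota (dtens capd (idd 1)) :: 'k abt" and ?b = "Tns PoleH crossX :: 'k abt"
    and ?c = "iota (dtens cupd (idd 1)) :: 'k abt"
  have "abeq \<delta> (Tns (Cmp ?a (Cmp ?b ?c)) (idd 1)) (Cmp (Tns ?a (idd 1)) (Tns (Cmp ?b ?c) (idd 1)))"
    by (rule Tns_Cmp) auto
  also have "abeq \<delta> \<dots> (Cmp (iota cap1) (Cmp (Tns PoleH X1) (iota cup1)))"
  proof (rule abeq.cong_cmp)
    have "abeq \<delta> (Tns (Cmp ?b ?c) (idd 1)) (Cmp (Tns ?b (idd 1)) (Tns ?c (idd 1)))"
      by (rule Tns_Cmp) auto
    also have "abeq \<delta> \<dots> (Cmp (Tns PoleH X1) (iota cup1))"
      by (intro abeq.cong_cmp Tns_iota abeq.tns_tns) auto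
    finally show "abeq \<delta> (Tns (Cmp ?b ?c) (idd 1)) (Cmp (Tns PoleH X1) (iota cup1))" .
    show "abeq \<delta> (Tns ?a (idd 1)) (iota cap1)" by (intro Tns_iota) auto
  qed auto
  finally have 1: "abeq \<delta> (Tns (Cmp ?a (Cmp ?b ?c)) (idd 1)) (Cmp (iota cap1) (Cmp (Tns PoleH X1) (iota cup1)))" .
  have "abeq \<delta> (Tns (Cmp ?a (Cmp ?b ?c)) (idd 1)) (Tns (Scl (-1) PoleH) (idd 1))"
    by (intro abeq.cong_tns abeq.skew) auto
  also have "abeq \<delta> \<dots> (Scl (-1) (Tns PoleH (idd 1)))" by (intro abeq.tns_scl) auto
  finally show ?thesis by (rule abeq.trans[OF abeq.sym[OF 1]])
qed

text \<open>Tensor the skew-symmetry relation with a strand and cap off. The caps \<open>{1,2},{3,4}\<close> with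
 the crossing of strands 2 and 3 become \<open>{1,3},{2,4}\<close>; the second of these arcs slides below the
 connector (\<open>down\<close>) and straightens against the cup into a crossing.\<close>

lemma cap_pole_cross:
  fixes \<delta> :: "'k::comm_ring_1"
  shows "abeq \<delta> (Cmp (iota capd) (Cmp (Tns PoleH (idd 1)) (iota crossX)))
     (Scl (-1) (Cmp (iota capd) (Tns PoleH (idd 1))))"
proof -
  let ?H1 = "Tns PoleH (idd 1) :: 'k abt" and ?H3 = "Tns PoleH (idd 3) :: 'k abt" and ?T = "Tns PoleH X1 :: 'k abt"
  let ?D = "iota (dtens (idd 1) down) :: 'k abt"
  have "abeq \<delta> (Cmp (iota capsA) ?T) (Cmp (iota capsA) (Cmp (iota (dtens (idd 1) X1)) ?H3))"
    using slide_above[of X1 \<delta>, THEN abeq.sym] by (intro cmpR) auto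
  also have "abeq \<delta> \<dots> (Cmp (Cmp (iota capsA) (iota (dtens (idd 1) X1))) ?H3)"
    by (intro abeq.sym[OF abeq.cmp_assoc]) auto
  also have "abeq \<delta> \<dots> (Cmp (iota capsB) ?H3)"
    by (intro cmpL iota_comp dcomp_arcs loops_arcs) auto
  also have "abeq \<delta> \<dots> (Cmp (Cmp (iota capd) ?D) ?H3)"
    by (intro cmpL abeq.sym[OF iota_comp] dcomp_arcs loops_arcs) auto
  also have "abeq \<delta> \<dots> (Cmp (iota capd) (Cmp ?D ?H3))" by (intro abeq.cmp_assoc) auto
  also have "abeq \<delta> \<dots> (Cmp (iota capd) (Cmp ?H1 ?D))"
    using slide[of down \<delta>] by (intro cmpR) (auto intro: abeq.sym)
  finally have slid: "abeq \<delta> (Cmp (iota capsA) ?T) (Cmp (iota capd) (Cmp ?H1 ?D))" .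

  have "abeq \<delta> (Cmp (iota capd) (Cmp (iota cap1) (Cmp ?T (iota cup1)))) (Cmp (iota capd) (Scl (-1) ?H1))"
    by (intro cmpR skew_tensor) auto
  also have "abeq \<delta> \<dots> (Scl (-1) (Cmp (iota capd) ?H1))" by (intro abeq.cmp_scl_r) auto
  finally have 1: "abeq \<delta> (Cmp (iota capd) (Cmp (iota cap1) (Cmp ?T (iota cup1)))) (Scl (-1) (Cmp (iota capd) ?H1))" .

  have "abeq \<delta> (Cmp (iota capd) (Cmp (iota cap1) (Cmp ?T (iota cup1))))
      (Cmp (Cmp (iota capd) (iota cap1)) (Cmp ?T (iota cup1)))"
    by (intro abeq.sym[OF abeq.cmp_assoc]) auto
  also have "abeq \<delta> \<dots> (Cmp (iota capsA) (Cmp ?T (iota cup1)))"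
    by (intro cmpL iota_comp dcomp_arcs loops_arcs) auto
  also have "abeq \<delta> \<dots> (Cmp (Cmp (iota capsA) ?T) (iota cup1))" by (intro abeq.sym[OF abeq.cmp_assoc]) auto
  also have "abeq \<delta> \<dots> (Cmp (Cmp (iota capd) (Cmp ?H1 ?D)) (iota cup1))" by (intro cmpL slid) auto
  also have "abeq \<delta> \<dots> (Cmp (iota capd) (Cmp (Cmp ?H1 ?D) (iota cup1)))" by (intro abeq.cmp_assoc) auto
  also have "abeq \<delta> \<dots> (Cmp (iota capd) (Cmp ?H1 (Cmp ?D (iota cup1))))"
    by (intro cmpR abeq.cmp_assoc) auto
  also have "abeq \<delta> \<dots> (Cmp (iota capd) (Cmp ?H1 (iota crossX)))"
    by (intro cmpR iota_comp dcomp_arcs loops_arcs) auto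
  finally show ?thesis using 1 by (blast intro: abeq.trans abeq.sym)
qed

text \<open>The preceding argument upside down: a cup is attached from below, the arc carried by
  \<open>up\<close> slides above the connector, and it straightens against the cap of the skew
  relation into a crossing.\<close>

lemma cross_pole_cup:
  fixes \<delta> :: "'k::comm_ring_1"
  shows "abeq \<delta> (Cmp (iota crossX) (Cmp (Tns PoleH (idd 1)) (iota cupd)))
     (Scl (-1) (Cmp (Tns PoleH (idd 1)) (iota cupd)))"
proof -
  let ?H1 = "Tns PoleH (idd 1) :: 'k abt" and ?H3 = "Tns PoleH (idd 3) :: 'k abt" and ?T = "Tns PoleH X1 :: 'k abt"
  let ?U = "iota (dtens (idd 1) up) :: 'k abt"
  have "abeq \<delta> (Cmp ?T (iota cupsA)) (Cmp (Cmp ?H3 (iota (dtens (idd 1) X1))) (iota cupsA))"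
    using slide_below[of X1 \<delta>, THEN abeq.sym] by (intro cmpL) auto
  also have "abeq \<delta> \<dots> (Cmp ?H3 (Cmp (iota (dtens (idd 1) X1)) (iota cupsA)))"
    by (intro abeq.cmp_assoc) auto
  also have "abeq \<delta> \<dots> (Cmp ?H3 (iota cupsB))"
    by (intro cmpR iota_comp dcomp_arcs loops_arcs) auto
  also have "abeq \<delta> \<dots> (Cmp ?H3 (Cmp ?U (iota cupd)))"
    by (intro cmpR abeq.sym[OF iota_comp] dcomp_arcs loops_arcs) auto
  also have "abeq \<delta> \<dots> (Cmp (Cmp ?H3 ?U) (iota cupd))" by (intro abeq.sym[OF abeq.cmp_assoc]) auto
  also have "abeq \<delta> \<dots> (Cmp (Cmp ?U ?H1) (iota cupd))"
    using slide[of up \<delta>] by (intro cmpL) auto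
  finally have slid: "abeq \<delta> (Cmp ?T (iota cupsA)) (Cmp (Cmp ?U ?H1) (iota cupd))" .

  have "abeq \<delta> (Cmp (Cmp (iota cap1) (Cmp ?T (iota cup1))) (iota cupd)) (Cmp (Scl (-1) ?H1) (iota cupd))"
    by (intro cmpL skew_tensor) auto
  also have "abeq \<delta> \<dots> (Scl (-1) (Cmp ?H1 (iota cupd)))" by (intro abeq.cmp_scl_l) auto
  finally have 1: "abeq \<delta> (Cmp (Cmp (iota cap1) (Cmp ?T (iota cup1))) (iota cupd)) (Scl (-1) (Cmp ?H1 (iota cupd)))" .

  have "abeq \<delta> (Cmp (Cmp (iota cap1) (Cmp ?T (iota cup1))) (iota cupd))
      (Cmp (iota cap1) (Cmp (Cmp ?T (iota cup1)) (iota cupd)))" by (intro abeq.cmp_assoc) auto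
  also have "abeq \<delta> \<dots> (Cmp (iota cap1) (Cmp ?T (Cmp (iota cup1) (iota cupd))))"
    by (intro cmpR abeq.cmp_assoc) auto
  also have "abeq \<delta> \<dots> (Cmp (iota cap1) (Cmp ?T (iota cupsA)))"
    by (intro cmpR iota_comp dcomp_arcs loops_arcs) auto
  also have "abeq \<delta> \<dots> (Cmp (iota cap1) (Cmp (Cmp ?U ?H1) (iota cupd)))" by (intro cmpR slid) auto
  also have "abeq \<delta> \<dots> (Cmp (iota cap1) (Cmp ?U (Cmp ?H1 (iota cupd))))"
    by (intro cmpR abeq.cmp_assoc) auto
  also have "abeq \<delta> \<dots> (Cmp (Cmp (iota cap1) ?U) (Cmp ?H1 (iota cupd)))"
    by (intro abeq.sym[OF abeq.cmp_assoc]) auto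
  also have "abeq \<delta> \<dots> (Cmp (iota crossX) (Cmp ?H1 (iota cupd)))"
    by (intro cmpL iota_comp dcomp_arcs loops_arcs) auto
  finally show ?thesis using 1 by (blast intro: abeq.trans abeq.sym)
qed


section \<open>From two strands to \<open>r\<close> strands\<close>

definition widen :: "'k::comm_ring_1 \<Rightarrow> nat \<Rightarrow> 'k abt \<Rightarrow> 'k endos" where
  "widen \<delta> m t = el \<delta> (m + 2) (Tns t (idd m))"

lemma widen_cong: "abeq \<delta> s t \<Longrightarrow> endo 2 s \<Longrightarrow> endo 2 t \<Longrightarrow> widen \<delta> m s = widen \<delta> m t"
  unfolding widen_def by (simp add: el_eq_iff abeq.cong_tns)

lemma widen_Cmp: "endo 2 s \<Longrightarrow> endo 2 t \<Longrightarrow> widen \<delta> m (Cmp s t) = widen \<delta> m s * widen \<delta> m t"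
  unfolding widen_def by (subst el_Cmp[symmetric]) (auto simp: el_eq_iff Tns_Cmp)

lemma widen_Pls: "endo 2 s \<Longrightarrow> endo 2 t \<Longrightarrow> widen \<delta> m (Pls s t) = widen \<delta> m s + widen \<delta> m t"
  unfolding widen_def by (subst el_Pls[symmetric]) (auto simp: el_eq_iff abeq.tns_pls)

lemma widen_neg: "endo 2 t \<Longrightarrow> widen \<delta> m (Scl (-1) t) = - widen \<delta> m t"
  unfolding widen_def by (subst el_neg[symmetric]) (auto simp: el_eq_iff abeq.tns_scl)

lemma widen_tminus: "endo 2 s \<Longrightarrow> endo 2 t \<Longrightarrow> widen \<delta> m (tminus s t) = widen \<delta> m s - widen \<delta> m t"
  by (simp add: tminus_def widen_Pls widen_neg)

lemma widen_Zr: "widen \<delta> m (Zr 2 2) = 0"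
proof -
  have "widen \<delta> m (Zr 2 2) = el \<delta> (m + 2) (Zr (m + 2) (m + 2))"
    unfolding widen_def using Tns_Zr[of "idd m" \<delta> 2 2] by (subst el_eq_iff) (auto simp: add.commute)
  then show ?thesis by (simp only: el_Zr)
qed

lemma widen_iota: "valid_diag D \<Longrightarrow> ddom D = 2 \<Longrightarrow> dcod D = 2 \<Longrightarrow>
    widen \<delta> m (iota D) = el \<delta> (m + 2) (iota (dtens D (idd m)))"
  unfolding widen_def by (subst el_eq_iff) (auto simp: Tns_iota)

lemma widen_crossX: "widen \<delta> m (iota crossX) = perm_el \<delta> (m + 2) (tr 0 1)"
  by (simp only: widen_iota valid_crossX crossX_sel dtens_crossX_idd perm_el_def)

lemma widen_ed: "widen \<delta> m (iota (ed 2 0 1)) = e_el \<delta> (m + 2) 0 1"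
  by (subst widen_iota) (simp_all add: dtens_ed_idd e_el_def del: One_nat_def add_2_eq_Suc')

lemma widen_pole: "widen \<delta> m (Tns PoleH (idd 1)) = pole_el \<delta> (m + 2)"
proof -
  have "abeq \<delta> (Tns (Tns PoleH (idd 1)) (idd m)) (Tns PoleH (idd (1 + m)))"
    unfolding dtens_idd_idd[symmetric] by (intro abeq.tns_tns) auto
  then show ?thesis unfolding widen_def pole_el_def by (subst el_eq_iff) auto
qed

lemma cup_cap: "abeq \<delta> (Cmp (iota cupd) (iota capd)) (iota (ed 2 0 1))"
  by (rule iota_comp) (auto simp: dcomp_cup_cap loops_cup_cap)

text \<open>Since the arc diagram is cup after cap, the cap lies next to the connector and
  \<open>cap_pole_cross\<close> applies; \<open>widen\<close> then supplies the remaining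
  strands.\<close>

lemma skew_right: "e_el \<delta> (m + 2) 0 1 * pole_el \<delta> (m + 2) * perm_el \<delta> (m + 2) (tr 0 1) = - (e_el \<delta> (m + 2) 0 1 * pole_el \<delta> (m + 2))"
proof -
  let ?H = "Tns PoleH (idd 1) :: 'a abt" and ?U = "iota cupd :: 'a abt" and ?C = "iota capd :: 'a abt"
    and ?X = "iota crossX :: 'a abt" and ?E = "iota (ed 2 0 1) :: 'a abt"
  have "abeq \<delta> (Cmp ?E (Cmp ?H ?X)) (Cmp (Cmp ?U ?C) (Cmp ?H ?X))"
    by (intro cmpL abeq.sym[OF cup_cap]) auto
  also have "abeq \<delta> \<dots> (Cmp ?U (Cmp ?C (Cmp ?H ?X)))" by (intro abeq.cmp_assoc) auto
  also have "abeq \<delta> \<dots> (Cmp ?U (Scl (-1) (Cmp ?C ?H)))" by (intro cmpR cap_pole_cross) auto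
  also have "abeq \<delta> \<dots> (Scl (-1) (Cmp ?U (Cmp ?C ?H)))" by (intro abeq.cmp_scl_r) auto
  also have "abeq \<delta> \<dots> (Scl (-1) (Cmp (Cmp ?U ?C) ?H))"
    by (intro abeq.cong_scl abeq.sym[OF abeq.cmp_assoc]) auto
  also have "abeq \<delta> \<dots> (Scl (-1) (Cmp ?E ?H))" by (intro abeq.cong_scl cmpL cup_cap) auto
  finally have "widen \<delta> m (Cmp ?E (Cmp ?H ?X)) = widen \<delta> m (Scl (-1) (Cmp ?E ?H))"
    by (rule widen_cong) auto
  then show ?thesis by (simp add: widen_Cmp widen_neg widen_crossX widen_ed[simplified] widen_pole[simplified] mult.assoc)
qed

lemma skew_left: "perm_el \<delta> (m + 2) (tr 0 1) * pole_el \<delta> (m + 2) * e_el \<delta> (m + 2) 0 1 = - (pole_el \<delta> (m + 2) * e_el \<delta> (m + 2) 0 1)"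
proof -
  let ?H = "Tns PoleH (idd 1) :: 'a abt" and ?U = "iota cupd :: 'a abt" and ?C = "iota capd :: 'a abt"
    and ?X = "iota crossX :: 'a abt" and ?E = "iota (ed 2 0 1) :: 'a abt"
  have "abeq \<delta> (Cmp ?X (Cmp ?H ?E)) (Cmp ?X (Cmp ?H (Cmp ?U ?C)))"
    by (intro cmpR abeq.sym[OF cup_cap]) auto
  also have "abeq \<delta> \<dots> (Cmp ?X (Cmp (Cmp ?H ?U) ?C))" by (intro cmpR abeq.sym[OF abeq.cmp_assoc]) auto
  also have "abeq \<delta> \<dots> (Cmp (Cmp ?X (Cmp ?H ?U)) ?C)" by (intro abeq.sym[OF abeq.cmp_assoc]) auto
  also have "abeq \<delta> \<dots> (Cmp (Scl (-1) (Cmp ?H ?U)) ?C)" by (intro cmpL cross_pole_cup) auto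
  also have "abeq \<delta> \<dots> (Scl (-1) (Cmp (Cmp ?H ?U) ?C))" by (intro abeq.cmp_scl_l) auto
  also have "abeq \<delta> \<dots> (Scl (-1) (Cmp ?H (Cmp ?U ?C)))" by (intro abeq.cong_scl abeq.cmp_assoc) auto
  also have "abeq \<delta> \<dots> (Scl (-1) (Cmp ?H ?E))" by (intro abeq.cong_scl cmpR cup_cap) auto
  finally have "widen \<delta> m (Cmp ?X (Cmp ?H ?E)) = widen \<delta> m (Scl (-1) (Cmp ?H ?E))"
    by (rule widen_cong) auto
  then show ?thesis by (simp add: widen_Cmp widen_neg widen_crossX widen_ed[simplified] widen_pole[simplified] mult.assoc)
qed

lemma four_term_pole:
  fixes \<delta> :: "'k::comm_ring_1"
  defines "s \<equiv> \<lambda>m. perm_el \<delta> (m + 2) (tr 0 1)"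
  shows "pole_el \<delta> (m + 2) * (s m * (pole_el \<delta> (m + 2) * s m) + (s m - e_el \<delta> (m + 2) 0 1))
       = (s m * (pole_el \<delta> (m + 2) * s m) + (s m - e_el \<delta> (m + 2) 0 1)) * pole_el \<delta> (m + 2)"
proof -
  let ?H = "Tns PoleH (idd 1) :: 'k abt" and ?X = "iota crossX :: 'k abt"
  let ?Y = "Pls (Cmp ?X (Cmp ?H ?X)) iotaH"
  have H: "endo 2 ?H" and Y: "endo 2 (iotaH :: 'k abt)" by (auto simp: iotaH_def)
  have "widen \<delta> m (Cmp (iota cupd) (iota capd)) = widen \<delta> m (iota (ed 2 0 1))"
    by (rule widen_cong[OF cup_cap]) auto
  then have "widen \<delta> m iotaH = widen \<delta> m ?X - widen \<delta> m (iota (ed 2 0 1))"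
    unfolding iotaH_def by (subst widen_tminus) auto
  then have 1: "widen \<delta> m iotaH = s m - e_el \<delta> (m + 2) 0 1"
    by (simp only: widen_crossX widen_ed s_def)
  have "widen \<delta> m (commut ?H ?Y) = 0"
    using widen_cong[OF abeq.four_term[of \<delta>], where m = m] H Y by (simp add: commut_def widen_Zr)
  then show ?thesis using H Y
    by (simp add: commut_def widen_tminus widen_Cmp widen_Pls 1 del: One_nat_def add_2_eq_Suc')
       (simp only: widen_crossX widen_pole s_def)
qed

text \<open>The arc absorbs a crossing, and moving that crossing across \<open>h_1\<close> turns it
  into \<open>h_0\<close>. So \<open>e h_1 = e h_0 s\<close>, which \<open>skew_right\<close>
  identifies with \<open>- e h_0\<close>; the other side is symmetric.\<close>

lemma skew_pole:
  assumes "r \<ge> 2"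
  shows "e_el \<delta> r 0 1 * (h_el \<delta> r 0 + h_el \<delta> r 1) = 0" "(h_el \<delta> r 0 + h_el \<delta> r 1) * e_el \<delta> r 0 1 = 0"
proof -
  obtain m where r: "r = m + 2" using assms by (metis add.commute le_iff_add)
  let ?s = "perm_el \<delta> r (tr 0 1)"
  have s: "pbij r (tr 0 1)" using assms by (intro pbij_tr) auto
  have s0: "?s * h_el \<delta> r 0 = h_el \<delta> r 1 * ?s" using perm_el_h_el[OF s, of 0 \<delta>] assms by simp
  have s1: "?s * h_el \<delta> r 1 = h_el \<delta> r 0 * ?s" using perm_el_h_el[OF s, of 1 \<delta>] assms by simp
  have sE: "?s * e_el \<delta> r 0 1 = e_el \<delta> r 0 1" "e_el \<delta> r 0 1 * ?s = e_el \<delta> r 0 1"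
    using perm_el_tr_e_el[of 0 r 1 \<delta>] assms by auto
  have pole: "pole_el \<delta> r = h_el \<delta> r 0" using assms by (simp add: h_el_0)
  have "e_el \<delta> r 0 1 * h_el \<delta> r 1 = (e_el \<delta> r 0 1 * ?s) * h_el \<delta> r 1" by (simp only: sE)
  also have "\<dots> = e_el \<delta> r 0 1 * pole_el \<delta> r * ?s" by (simp only: s1 pole mult.assoc)
  finally have h1: "e_el \<delta> r 0 1 * h_el \<delta> r 1 = e_el \<delta> r 0 1 * pole_el \<delta> r * ?s" .
  have "h_el \<delta> r 1 * e_el \<delta> r 0 1 = h_el \<delta> r 1 * (?s * e_el \<delta> r 0 1)" by (simp only: sE)
  also have "\<dots> = ?s * pole_el \<delta> r * e_el \<delta> r 0 1" by (simp only: s0[symmetric] pole mult.assoc[symmetric])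
  finally have h1': "h_el \<delta> r 1 * e_el \<delta> r 0 1 = ?s * pole_el \<delta> r * e_el \<delta> r 0 1" .
  show "e_el \<delta> r 0 1 * (h_el \<delta> r 0 + h_el \<delta> r 1) = 0"
    using skew_right[of \<delta> m] by (simp only: distrib_left h1 pole r[symmetric]) simp
  show "(h_el \<delta> r 0 + h_el \<delta> r 1) * e_el \<delta> r 0 1 = 0"
    using skew_left[of \<delta> m] by (simp only: distrib_right h1' pole r[symmetric]) simp
qed

text \<open>\<open>perm_el \<delta> r id\<close> is the unit of the factor \<open>End(r)\<close> only, so cancellation needs the last two
 premises.\<close>

lemma perm_el_cancel_right:
  assumes "pbij r \<pi>" "x * perm_el \<delta> r \<pi> = y * perm_el \<delta> r \<pi>" "x * perm_el \<delta> r id = x" "y * perm_el \<delta> r id = y"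
  shows "x = y"
proof -
  have "x * (perm_el \<delta> r \<pi> * perm_el \<delta> r (inv_into {..<r} \<pi>)) = y * (perm_el \<delta> r \<pi> * perm_el \<delta> r (inv_into {..<r} \<pi>))"
    using assms(2) by (simp add: mult.assoc[symmetric])
  then show ?thesis using assms by (simp add: perm_el_inv)
qed

lemma two_point_perm:
  assumes "i < r" "j < r" "i \<noteq> j"
  obtains \<pi> where "pbij r \<pi>" "\<pi> 0 = i" "\<pi> 1 = j"
proof
  have "0 < r" "1 < r" using assms by auto
  moreover have "tr 0 i j < r" using assms by (auto simp: tr_def)
  \<comment> \<open>As \<open>j\<close> differs from \<open>i\<close>, the value
    \<open>tr 0 i j\<close> is not \<open>0\<close>. The inner transposition therefore fixes
    \<open>0\<close> and sends \<open>1\<close> to the point that \<open>tr 0 i\<close> moves to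
    \<open>j\<close>.\<close>
  ultimately show "pbij r (tr 0 i \<circ> tr 1 (tr 0 i j))" using assms by (intro pbij_comp pbij_tr) auto
  show "(tr 0 i \<circ> tr 1 (tr 0 i j)) 0 = i" "(tr 0 i \<circ> tr 1 (tr 0 i j)) 1 = j"
    using assms by (auto simp: tr_def)
qed

lemma h_el_id: "i < r \<Longrightarrow> h_el \<delta> r i * perm_el \<delta> r id = h_el \<delta> r i"
  by (simp add: h_el_def perm_el_id_right)

lemma e_el_id: "i < r \<Longrightarrow> j < r \<Longrightarrow> i \<noteq> j \<Longrightarrow> e_el \<delta> r i j * perm_el \<delta> r id = e_el \<delta> r i j"
  by (simp add: e_el_def perm_el_id_right)

lemma perm_el_id: "pbij r \<pi> \<Longrightarrow> perm_el \<delta> r \<pi> * perm_el \<delta> r id = perm_el \<delta> r \<pi>"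
  by (simp add: perm_el_def perm_el_id_right[unfolded perm_el_def])

lemma e_el_h_el_sum:
  assumes "i < r" "j < r" "i \<noteq> j"
  shows "e_el \<delta> r i j * (h_el \<delta> r i + h_el \<delta> r j) = 0" "(h_el \<delta> r i + h_el \<delta> r j) * e_el \<delta> r i j = 0"
proof -
  obtain \<pi> where \<pi>: "pbij r \<pi>" "\<pi> 0 = i" "\<pi> 1 = j" using two_point_perm[OF assms] .
  have r: "r \<ge> 2" using assms by auto
  let ?h = "h_el \<delta> r 0 + h_el \<delta> r 1"
  have h: "(h_el \<delta> r i + h_el \<delta> r j) * perm_el \<delta> r \<pi> = perm_el \<delta> r \<pi> * ?h"
    using perm_el_h_el[OF \<pi>(1), of 0 \<delta>] perm_el_h_el[OF \<pi>(1), of 1 \<delta>] r \<pi> by (simp add: algebra_simps)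
  have e: "e_el \<delta> r i j * perm_el \<delta> r \<pi> = perm_el \<delta> r \<pi> * e_el \<delta> r 0 1"
    using perm_el_e_el[OF \<pi>(1), of 0 1 \<delta>] r \<pi> by simp
  show "e_el \<delta> r i j * (h_el \<delta> r i + h_el \<delta> r j) = 0"
  proof (rule perm_el_cancel_right[OF \<pi>(1)])
    have "e_el \<delta> r i j * (h_el \<delta> r i + h_el \<delta> r j) * perm_el \<delta> r \<pi> = (e_el \<delta> r i j * perm_el \<delta> r \<pi>) * ?h"
      by (simp only: mult.assoc h)
    then show "e_el \<delta> r i j * (h_el \<delta> r i + h_el \<delta> r j) * perm_el \<delta> r \<pi> = 0 * perm_el \<delta> r \<pi>"
      by (simp only: e mult.assoc skew_pole[OF r] mult_zero_left mult_zero_right)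
  qed (use assms in \<open>simp_all add: mult.assoc distrib_right h_el_id\<close>)
  show "(h_el \<delta> r i + h_el \<delta> r j) * e_el \<delta> r i j = 0"
  proof (rule perm_el_cancel_right[OF \<pi>(1)])
    have "(h_el \<delta> r i + h_el \<delta> r j) * e_el \<delta> r i j * perm_el \<delta> r \<pi> = ((h_el \<delta> r i + h_el \<delta> r j) * perm_el \<delta> r \<pi>) * e_el \<delta> r 0 1"
      by (simp only: mult.assoc e)
    then show "(h_el \<delta> r i + h_el \<delta> r j) * e_el \<delta> r i j * perm_el \<delta> r \<pi> = 0 * perm_el \<delta> r \<pi>"
      by (simp only: h mult.assoc skew_pole[OF r] mult_zero_left mult_zero_right)
  qed (use assms in \<open>simp_all add: mult.assoc e_el_id\<close>)
qed

section \<open>The Brauer elements \<open>H_ij\<close>\<close>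

definition H_el :: "'k::comm_ring_1 \<Rightarrow> nat \<Rightarrow> nat \<Rightarrow> nat \<Rightarrow> 'k endos" where
  "H_el \<delta> r i j = perm_el \<delta> r (tr i j) - e_el \<delta> r i j"

lemma H_el_commute: "H_el \<delta> r i j = H_el \<delta> r j i"
  unfolding H_el_def by (simp only: e_el_commute[of _ _ i j] perm_el_tr_commute[of _ _ i j])

lemma H_el_id: "i < r \<Longrightarrow> j < r \<Longrightarrow> i \<noteq> j \<Longrightarrow> H_el \<delta> r i j * perm_el \<delta> r id = H_el \<delta> r i j"
  by (simp add: H_el_def left_diff_distrib perm_el_id e_el_id pbij_tr)

lemma perm_el_tr_conj:
  assumes "pbij r \<pi>" "i < r" "j < r"
  shows "perm_el \<delta> r \<pi> * perm_el \<delta> r (tr i j) = perm_el \<delta> r (tr (\<pi> i) (\<pi> j)) * perm_el \<delta> r \<pi>"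
  using assms by (auto simp: perm_el_mult pbij_tr pbij_less tr_def pbij_eq_iff intro!: perm_el_cong)

lemma perm_el_H_el:
  assumes "pbij r \<pi>" "i < r" "j < r" "i \<noteq> j"
  shows "perm_el \<delta> r \<pi> * H_el \<delta> r i j = H_el \<delta> r (\<pi> i) (\<pi> j) * perm_el \<delta> r \<pi>"
  using assms by (simp add: H_el_def algebra_simps perm_el_tr_conj perm_el_e_el)

lemma perm_el_tr_e_el_disjoint:
  assumes "i < r" "j < r" "k < r" "l < r" "distinct [i, j, k, l]"
  shows "perm_el \<delta> r (tr i j) * e_el \<delta> r k l = e_el \<delta> r k l * perm_el \<delta> r (tr i j)"
  using perm_el_e_el[OF pbij_tr, of i r j k l \<delta>] assms by simp

lemma e_el_H_el_disjoint:
  assumes "i < r" "j < r" "k < r" "l < r" "distinct [i, j, k, l]"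
  shows "e_el \<delta> r i j * H_el \<delta> r k l = H_el \<delta> r k l * e_el \<delta> r i j"
proof -
  have "distinct [k, l, i, j]" using assms(5) by auto
  then show ?thesis
    using perm_el_tr_e_el_disjoint[of k r l i j \<delta>] e_el_disjoint[OF assms, of \<delta>] assms by (simp add: H_el_def algebra_simps)
qed

lemma H_el_disjoint:
  assumes "i < r" "j < r" "k < r" "l < r" "distinct [i, j, k, l]"
  shows "H_el \<delta> r i j * H_el \<delta> r k l = H_el \<delta> r k l * H_el \<delta> r i j"
proof -
  have "perm_el \<delta> r (tr i j) * H_el \<delta> r k l = H_el \<delta> r k l * perm_el \<delta> r (tr i j)"
    using perm_el_H_el[OF pbij_tr, of i r j k l \<delta>] assms by simp
  then show ?thesis using e_el_H_el_disjoint[OF assms, of \<delta>]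
    unfolding H_el_def[of \<delta> r i j] by (simp only: left_diff_distrib right_diff_distrib)
qed

lemma H_el_h_el:
  assumes "i < r" "k < r" "l < r" "distinct [i, k, l]"
  shows "H_el \<delta> r k l * h_el \<delta> r i = h_el \<delta> r i * H_el \<delta> r k l"
  using perm_el_h_el[OF pbij_tr, of k r l i \<delta>] e_el_h_el[OF assms, of \<delta>] assms
  by (simp add: H_el_def left_diff_distrib right_diff_distrib)

text \<open>By \<open>e_el_adjacent\<close>, \<open>e_ij e_jk = e_ij (i k)\<close> and
  \<open>e_ij e_ik = e_ij (j k)\<close>, so the four products cancel crosswise. For the other side,
  conjugation first rewrites \<open>(i k) e_ij\<close> as \<open>e_kj (k i)\<close>, which is again
  a product of two arcs.\<close>

lemma e_el_H_el_sum:
  assumes "i < r" "j < r" "k < r" "distinct [i, j, k]"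
  shows "e_el \<delta> r i j * (H_el \<delta> r i k + H_el \<delta> r j k) = 0" "(H_el \<delta> r i k + H_el \<delta> r j k) * e_el \<delta> r i j = 0"
proof -
  have 1: "e_el \<delta> r i j * e_el \<delta> r j k = e_el \<delta> r i j * perm_el \<delta> r (tr i k)"
    and 2: "e_el \<delta> r i j * e_el \<delta> r i k = e_el \<delta> r i j * perm_el \<delta> r (tr j k)"
    using e_el_adjacent[of i r j k \<delta>] e_el_adjacent[of j r i k \<delta>] assms by (auto simp: e_el_commute[of \<delta> r j i])
  then show "e_el \<delta> r i j * (H_el \<delta> r i k + H_el \<delta> r j k) = 0"
    by (simp add: H_el_def algebra_simps)
  have "perm_el \<delta> r (tr i k) * e_el \<delta> r i j = e_el \<delta> r k j * perm_el \<delta> r (tr k i)"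
    using perm_el_e_el[OF pbij_tr, of i r k i j \<delta>] assms by (simp add: perm_el_tr_commute[of \<delta> r k i])
  moreover have "e_el \<delta> r k j * perm_el \<delta> r (tr k i) = e_el \<delta> r k j * e_el \<delta> r j i"
    using e_el_adjacent[of k r j i \<delta>] assms by auto
  moreover have "perm_el \<delta> r (tr j k) * e_el \<delta> r j i = e_el \<delta> r k i * perm_el \<delta> r (tr k j)"
    using perm_el_e_el[OF pbij_tr, of j r k j i \<delta>] assms by (simp add: perm_el_tr_commute[of \<delta> r k j])
  moreover have "e_el \<delta> r k i * perm_el \<delta> r (tr k j) = e_el \<delta> r k i * e_el \<delta> r i j"
    using e_el_adjacent[of k r i j \<delta>] assms by auto
  ultimately show "(H_el \<delta> r i k + H_el \<delta> r j k) * e_el \<delta> r i j = 0"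
    by (simp add: H_el_def algebra_simps e_el_commute[of \<delta> r j i] e_el_commute[of \<delta> r k i] e_el_commute[of \<delta> r k j])
qed

text \<open>The transposition \<open>(i j)\<close> swaps the two summands and so commutes with their
  sum; the arc part of \<open>H_ij\<close> annihilates the sum from either side.\<close>

lemma four_term_H_el:
  assumes "i < r" "j < r" "k < r" "distinct [i, j, k]"
  shows "H_el \<delta> r i j * (H_el \<delta> r i k + H_el \<delta> r j k) = (H_el \<delta> r i k + H_el \<delta> r j k) * H_el \<delta> r i j"
proof -
  have "perm_el \<delta> r (tr i j) * (H_el \<delta> r i k + H_el \<delta> r j k) = (H_el \<delta> r i k + H_el \<delta> r j k) * perm_el \<delta> r (tr i j)"
    using perm_el_H_el[OF pbij_tr, of i r j i k \<delta>] perm_el_H_el[OF pbij_tr, of i r j j k \<delta>] assms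
    by (simp add: distrib_left distrib_right add.commute)
  then show ?thesis using e_el_H_el_sum[OF assms, of \<delta>]
    unfolding H_el_def[of \<delta> r i j] by (simp only: left_diff_distrib right_diff_distrib)
qed

lemma four_term_h_el:
  assumes "i < r" "j < r" "i \<noteq> j"
  shows "h_el \<delta> r i * (h_el \<delta> r j + H_el \<delta> r i j) = (h_el \<delta> r j + H_el \<delta> r i j) * h_el \<delta> r i"
proof -
  obtain \<pi> where \<pi>: "pbij r \<pi>" "\<pi> 0 = i" "\<pi> 1 = j" using two_point_perm[OF assms] .
  have r: "r \<ge> 2" using assms by auto
  then obtain m where m: "r = m + 2" by (metis add.commute le_iff_add)
  let ?s = "perm_el \<delta> r (tr 0 1)" and ?g = "h_el \<delta> r 1 + H_el \<delta> r 0 1"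
  \<comment> \<open>The defining relation mentions the crossing conjugate of the connector. This
    conjugate is \<open>h_1\<close>, which gives the relation the shape that permutations can
    transport.\<close>
  have "?s * h_el \<delta> r 0 = h_el \<delta> r 1 * ?s" using perm_el_h_el[OF pbij_tr, of 0 r 1 0 \<delta>] r by simp
  then have "?s * pole_el \<delta> r * ?s = h_el \<delta> r 1 * (?s * ?s)" using r by (simp add: h_el_0 mult.assoc)
  then have "?s * pole_el \<delta> r * ?s = h_el \<delta> r 1" using r by (simp only: perm_el_tr_tr) (simp add: perm_el_tr_tr h_el_id)
  then have base: "h_el \<delta> r 0 * ?g = ?g * h_el \<delta> r 0"
    using four_term_pole[of \<delta> m] r by (simp add: h_el_0 H_el_def m mult.assoc)
  have g: "(h_el \<delta> r j + H_el \<delta> r i j) * perm_el \<delta> r \<pi> = perm_el \<delta> r \<pi> * ?g"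
    using perm_el_h_el[OF \<pi>(1), of 1 \<delta>] perm_el_H_el[OF \<pi>(1), of 0 1 \<delta>] r \<pi> by (simp add: distrib_left distrib_right)
  have h0: "h_el \<delta> r i * perm_el \<delta> r \<pi> = perm_el \<delta> r \<pi> * h_el \<delta> r 0"
    using perm_el_h_el[OF \<pi>(1), of 0 \<delta>] r \<pi> by simp
  show ?thesis
  proof (rule perm_el_cancel_right[OF \<pi>(1)])
    have "h_el \<delta> r i * (h_el \<delta> r j + H_el \<delta> r i j) * perm_el \<delta> r \<pi> = (h_el \<delta> r i * perm_el \<delta> r \<pi>) * ?g"
      by (simp only: mult.assoc g)
    also have "\<dots> = perm_el \<delta> r \<pi> * (?g * h_el \<delta> r 0)" by (simp only: mult.assoc h0 base)
    also have "\<dots> = (perm_el \<delta> r \<pi> * ?g) * h_el \<delta> r 0" by (simp only: mult.assoc)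
    also have "\<dots> = (h_el \<delta> r j + H_el \<delta> r i j) * (h_el \<delta> r i * perm_el \<delta> r \<pi>)" by (simp only: g[symmetric] h0 mult.assoc)
    finally show "h_el \<delta> r i * (h_el \<delta> r j + H_el \<delta> r i j) * perm_el \<delta> r \<pi> = (h_el \<delta> r j + H_el \<delta> r i j) * h_el \<delta> r i * perm_el \<delta> r \<pi>"
      by (simp only: mult.assoc)
  qed (use assms in \<open>simp_all add: mult.assoc distrib_right h_el_id H_el_id\<close>)
qed

section \<open>The Jucys--Murphy type elements\<close>

definition Theta_el :: "'k::comm_ring_1 \<Rightarrow> nat \<Rightarrow> nat \<Rightarrow> 'k endos" where
  "Theta_el \<delta> r j = h_el \<delta> r j + (\<Sum>a<j. H_el \<delta> r a j)"

lemma endo_HHij [simp]: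
  "0 < i \<Longrightarrow> i < j \<Longrightarrow> j \<le> r \<Longrightarrow> wt (HHij r i j)" "tdom (HHij r i j) = r" "tcod (HHij r i j) = r"
proof -
  have "transpd r i j = permd r (tr (i - 1) (j - 1))" by (simp add: transpd_def)
  moreover have "eijd r i j = ed r (i - 1) (j - 1)" if "0 < i" "i < j"
    using that by (simp add: ed_def)
  ultimately show "wt (HHij r i j)" if "0 < i" "i < j" "j \<le> r"
    using that by (auto simp: HHij_def pbij_tr)
  show "tdom (HHij r i j) = r" "tcod (HHij r i j) = r" by (auto simp: HHij_def transpd_def)
qed

lemma el_HHij:
  assumes "a < j" "j < r"
  shows "el \<delta> r (HHij r (Suc a) (Suc j)) = H_el \<delta> r a j"
  using assms unfolding HHij_def
  by (subst el_tminus) (auto simp: H_el_def perm_el_def e_el_def transpd_def ed_def[symmetric] pbij_tr)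

lemma endo_tsum: "\<forall>x\<in>set xs. endo r x \<Longrightarrow> endo r (tsum r r xs)"
  by (induction xs) auto

lemma el_tsum: "\<forall>x\<in>set xs. endo r x \<Longrightarrow> el \<delta> r (tsum r r xs) = sum_list (map (el \<delta> r) xs)"
  by (induction xs) (auto simp: el_Zr el_Pls endo_tsum)

lemma endo_Theta [simp]: "j < r \<Longrightarrow> endo r (Theta r (Suc j))"
  unfolding Theta_def by (rule endo_tsum) auto

lemma el_Theta:
  assumes "j < r"
  shows "el \<delta> r (Theta r (Suc j)) = Theta_el \<delta> r j"
proof -
  have "el \<delta> r (Theta r (Suc j)) = h_el \<delta> r j + sum_list (map (\<lambda>a. el \<delta> r (HHij r a (Suc j))) [1..<Suc j])"
    unfolding Theta_def using assms
    by (subst el_tsum) (auto simp: h_el_def o_def simp del: upt_Suc)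
  also have "sum_list (map (\<lambda>a. el \<delta> r (HHij r a (Suc j))) [1..<Suc j]) = (\<Sum>a=1..<Suc j. el \<delta> r (HHij r a (Suc j)))"
    by (simp only: interv_sum_list_conv_sum_set_nat set_upt)
  also have "\<dots> = (\<Sum>a<j. el \<delta> r (HHij r (Suc a) (Suc j)))"
    by (rule sum.reindex_bij_witness[where i = Suc and j = "\<lambda>a. a - 1"]) auto
  also have "\<dots> = (\<Sum>a<j. H_el \<delta> r a j)" using assms by (intro sum.cong) (auto simp: el_HHij)
  finally show ?thesis by (simp add: Theta_el_def)
qed

text \<open>An element acting on strands \<open>a\<close> and \<open>b\<close> need not commute with
  the two isolated summands one by one, but it can be handled with their sum.\<close>

lemma Theta_el_split:
  assumes "a < j" "b < j" "a \<noteq> b"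
  shows "Theta_el \<delta> r j = h_el \<delta> r j + (H_el \<delta> r a j + H_el \<delta> r b j) + (\<Sum>c\<in>{..<j} - {a, b}. H_el \<delta> r c j)"
proof -
  have "(\<Sum>c<j. H_el \<delta> r c j) = (\<Sum>c\<in>{..<j} - {a, b}. H_el \<delta> r c j) + (\<Sum>c\<in>{a, b}. H_el \<delta> r c j)"
    using assms by (intro sum.subset_diff) auto
  then show ?thesis using assms by (simp add: Theta_el_def add_ac)
qed

lemma Theta_el_split1:
  assumes "a < j"
  shows "Theta_el \<delta> r j = (h_el \<delta> r j + H_el \<delta> r a j) + (\<Sum>c\<in>{..<j} - {a}. H_el \<delta> r c j)"
proof -
  have "(\<Sum>c<j. H_el \<delta> r c j) = (\<Sum>c\<in>{..<j} - {a}. H_el \<delta> r c j) + (\<Sum>c\<in>{a}. H_el \<delta> r c j)"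
    using assms by (intro sum.subset_diff) auto
  then show ?thesis by (simp add: Theta_el_def add_ac)
qed

lemma commute_sum:
  fixes x :: "'a::semiring_0"
  assumes "\<And>c. c \<in> A \<Longrightarrow> x * f c = f c * x"
  shows "x * sum f A = sum f A * x"
  using assms by (simp add: sum_distrib_left sum_distrib_right)

text \<open>Only \<open>h_j\<close> and \<open>H_ij\<close> share the pole or strand
  \<open>i\<close> with \<open>h_i\<close>; together they are covered by the four-term
  relation.\<close>

lemma h_el_Theta_el:
  assumes "i < j" "j < r"
  shows "h_el \<delta> r i * Theta_el \<delta> r j = Theta_el \<delta> r j * h_el \<delta> r i"
proof -
  have "h_el \<delta> r i * (\<Sum>c\<in>{..<j} - {i}. H_el \<delta> r c j) = (\<Sum>c\<in>{..<j} - {i}. H_el \<delta> r c j) * h_el \<delta> r i"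
    using assms by (intro commute_sum H_el_h_el[symmetric]) auto
  moreover have "h_el \<delta> r i * (h_el \<delta> r j + H_el \<delta> r i j) = (h_el \<delta> r j + H_el \<delta> r i j) * h_el \<delta> r i"
    using assms by (intro four_term_h_el) auto
  ultimately show ?thesis
    unfolding Theta_el_split1[OF assms(1)] by (simp only: distrib_left distrib_right[of _ _ "h_el \<delta> r i"])
qed

text \<open>\<open>h_j\<close> and the \<open>H_cj\<close> with \<open>c\<close> outside
  \<open>a\<close>, \<open>i\<close> have no strand in common with \<open>H_ai\<close>; the pair
  \<open>H_aj + H_ij\<close> is the Brauer four-term case.\<close>

lemma H_el_Theta_el:
  assumes "a < i" "i < j" "j < r"
  shows "H_el \<delta> r a i * Theta_el \<delta> r j = Theta_el \<delta> r j * H_el \<delta> r a i"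
proof -
  let ?R = "\<Sum>c\<in>{..<j} - {a, i}. H_el \<delta> r c j"
  have "H_el \<delta> r a i * ?R = ?R * H_el \<delta> r a i"
    using assms by (intro commute_sum H_el_disjoint) auto
  moreover have "H_el \<delta> r a i * h_el \<delta> r j = h_el \<delta> r j * H_el \<delta> r a i"
    using assms by (intro H_el_h_el) auto
  moreover have "H_el \<delta> r a i * (H_el \<delta> r a j + H_el \<delta> r i j) = (H_el \<delta> r a j + H_el \<delta> r i j) * H_el \<delta> r a i"
    using assms by (intro four_term_H_el) auto
  moreover have "Theta_el \<delta> r j = h_el \<delta> r j + (H_el \<delta> r a j + H_el \<delta> r i j) + ?R"
    using assms by (intro Theta_el_split) auto
  ultimately show ?thesis
    by (simp only: distrib_left[of "H_el \<delta> r a i"] distrib_right[of _ _ "H_el \<delta> r a i"])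
qed

lemma Theta_el_commute_less:
  assumes "i < j" "j < r"
  shows "Theta_el \<delta> r i * Theta_el \<delta> r j = Theta_el \<delta> r j * Theta_el \<delta> r i"
proof -
  have "Theta_el \<delta> r j * (\<Sum>a<i. H_el \<delta> r a i) = (\<Sum>a<i. H_el \<delta> r a i) * Theta_el \<delta> r j"
    using assms by (intro commute_sum H_el_Theta_el[symmetric]) auto
  then show ?thesis using h_el_Theta_el[OF assms, of \<delta>]
    unfolding Theta_el_def[of \<delta> r i] by (simp only: distrib_left distrib_right)
qed

lemma Theta_el_commute: "i < r \<Longrightarrow> j < r \<Longrightarrow> Theta_el \<delta> r i * Theta_el \<delta> r j = Theta_el \<delta> r j * Theta_el \<delta> r i"
  using Theta_el_commute_less[of i j r \<delta>] Theta_el_commute_less[of j i r \<delta>] by (cases i j rule: linorder_cases) auto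

section \<open>Relations with crossings and arcs\<close>

lemma cross_Theta_el:
  assumes "Suc k < r" "j < r" "j \<noteq> k" "j \<noteq> Suc k"
  shows "perm_el \<delta> r (tr k (Suc k)) * Theta_el \<delta> r j = Theta_el \<delta> r j * perm_el \<delta> r (tr k (Suc k))"
proof -
  let ?t = "tr k (Suc k)"
  have t: "pbij r ?t" using assms by (intro pbij_tr) auto
  have "perm_el \<delta> r ?t * (\<Sum>a<j. H_el \<delta> r a j) = (\<Sum>a<j. H_el \<delta> r (?t a) j) * perm_el \<delta> r ?t"
    unfolding sum_distrib_left sum_distrib_right
  proof (rule sum.cong)
    fix a assume "a \<in> {..<j}"
    then show "perm_el \<delta> r ?t * H_el \<delta> r a j = H_el \<delta> r (?t a) j * perm_el \<delta> r ?t"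
      using perm_el_H_el[OF t, of a j \<delta>] assms by simp
  qed auto
  \<comment> \<open>The transposition permutes the index set: as \<open>j\<close> is not
    \<open>Suc k\<close>, the set contains both \<open>k\<close> and \<open>Suc k\<close> or
    neither.\<close>
  also have "(\<Sum>a<j. H_el \<delta> r (?t a) j) = (\<Sum>a<j. H_el \<delta> r a j)"
    using assms by (intro sum.reindex_bij_witness[where i = ?t and j = ?t]) (auto simp: tr_def)
  finally show ?thesis using perm_el_h_el[OF t, of j \<delta>] assms by (simp add: Theta_el_def distrib_left distrib_right)
qed

lemma e_el_Theta_el:
  assumes "Suc k < r" "j < r" "j \<noteq> k" "j \<noteq> Suc k"
  shows "e_el \<delta> r k (Suc k) * Theta_el \<delta> r j = Theta_el \<delta> r j * e_el \<delta> r k (Suc k)"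
proof (cases "j < k")
  case True
  have "e_el \<delta> r k (Suc k) * (\<Sum>a<j. H_el \<delta> r a j) = (\<Sum>a<j. H_el \<delta> r a j) * e_el \<delta> r k (Suc k)"
    using assms True by (intro commute_sum e_el_H_el_disjoint) auto
  moreover have "e_el \<delta> r k (Suc k) * h_el \<delta> r j = h_el \<delta> r j * e_el \<delta> r k (Suc k)"
    using assms by (intro e_el_h_el) auto
  ultimately show ?thesis by (simp add: Theta_el_def distrib_left distrib_right)
next
  \<comment> \<open>Here \<open>j\<close> exceeds \<open>Suc k\<close>, so both strands of the arc
    occur among the indices. Their pair of summands is annihilated from both sides and all other
    terms are disjoint from the arc.\<close>
  case False
  let ?R = "\<Sum>c\<in>{..<j} - {k, Suc k}. H_el \<delta> r c j"
  have "e_el \<delta> r k (Suc k) * ?R = ?R * e_el \<delta> r k (Suc k)"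
    using assms by (intro commute_sum e_el_H_el_disjoint) auto
  moreover have "e_el \<delta> r k (Suc k) * h_el \<delta> r j = h_el \<delta> r j * e_el \<delta> r k (Suc k)"
    using assms by (intro e_el_h_el) auto
  moreover have "e_el \<delta> r k (Suc k) * (H_el \<delta> r k j + H_el \<delta> r (Suc k) j) = 0"
    "(H_el \<delta> r k j + H_el \<delta> r (Suc k) j) * e_el \<delta> r k (Suc k) = 0"
    using assms by (intro e_el_H_el_sum; simp)+
  moreover have "Theta_el \<delta> r j = h_el \<delta> r j + (H_el \<delta> r k j + H_el \<delta> r (Suc k) j) + ?R"
    using assms False by (intro Theta_el_split) auto
  ultimately show ?thesis
    by (simp only: distrib_left[of "e_el \<delta> r k (Suc k)"] distrib_right[of _ _ "e_el \<delta> r k (Suc k)"])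
qed

text \<open>The crossing exchanges the terms common to both sums. The extra summand
  \<open>H_(k,k+1) = s - e\<close> of the longer one, multiplied by \<open>s\<close>, contributes
  the identity minus \<open>e\<close>.\<close>

lemma cross_Theta_el_adjacent:
  fixes \<delta> :: "'k::comm_ring_1"
  assumes "Suc k < r"
  defines "s \<equiv> perm_el \<delta> r (tr k (Suc k))" and "e \<equiv> e_el \<delta> r k (Suc k)"
  shows "s * Theta_el \<delta> r k - Theta_el \<delta> r (Suc k) * s = e - perm_el \<delta> r id"
    and "Theta_el \<delta> r k * s - s * Theta_el \<delta> r (Suc k) = e - perm_el \<delta> r id"
proof -
  let ?t = "tr k (Suc k)"
  have t: "pbij r ?t" using assms by (intro pbij_tr) auto
  \<comment> \<open>The range of the sum stays below \<open>k\<close> for both values of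
    \<open>j\<close>, so \<open>?R (Suc k)\<close> leaves out exactly the summand at
    \<open>a = k\<close>.\<close>
  let ?R = "\<lambda>j. h_el \<delta> r j + (\<Sum>a<k. H_el \<delta> r a j)"
  have conj: "s * ?R j = ?R (?t j) * s" if "j = k \<or> j = Suc k" for j
  proof -
    have "perm_el \<delta> r ?t * H_el \<delta> r a j = H_el \<delta> r a (?t j) * perm_el \<delta> r ?t" if "a < k" for a
      using perm_el_H_el[OF t, of a j \<delta>] assms(1) that \<open>j = k \<or> j = Suc k\<close> by auto
    then show ?thesis using perm_el_h_el[OF t, of j \<delta>] assms(1) that
      by (auto simp: s_def distrib_left distrib_right sum_distrib_left sum_distrib_right)
  qed
  have ss: "s * s = perm_el \<delta> r id" and se: "s * e = e" "e * s = e"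
    using assms(1) by (auto simp: s_def e_def perm_el_tr_tr perm_el_tr_e_el)
  have Th: "Theta_el \<delta> r k = ?R k" "Theta_el \<delta> r (Suc k) = ?R (Suc k) + (s - e)"
    by (auto simp: Theta_el_def H_el_def s_def e_def)
  show "s * Theta_el \<delta> r k - Theta_el \<delta> r (Suc k) * s = e - perm_el \<delta> r id"
    unfolding Th using conj[of k] by (simp add: distrib_right[of _ _ "s"] left_diff_distrib ss se)
  show "Theta_el \<delta> r k * s - s * Theta_el \<delta> r (Suc k) = e - perm_el \<delta> r id"
    unfolding Th using conj[of "Suc k"] by (simp add: distrib_left[of "s"] right_diff_distrib ss se)
qed

lemma el_Scl_one_minus:
  assumes "endo r t"
  shows "el \<delta> r (Scl (1 - a) t) = el \<delta> r t - el \<delta> r (Scl a t)"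
proof -
  have "abeq \<delta> (Pls (Scl (1 - a) t) (Scl a t)) (Scl (1 - a + a) t)"
    using assms by (intro abeq.sym[OF abeq.scl_add]) auto
  also have "Scl (1 - a + a) t = Scl 1 t" by simp
  also have "abeq \<delta> (Scl 1 t) t" using assms by (intro abeq.scl_one) auto
  finally have "el \<delta> r (Pls (Scl (1 - a) t) (Scl a t)) = el \<delta> r t"
    using assms by (subst el_eq_iff) auto
  then show ?thesis using assms by (simp add: el_Pls algebra_simps)
qed

text \<open>The arc annihilates \<open>h_k + h_(k+1)\<close> and each
  \<open>H_ak + H_a(k+1)\<close>. Only \<open>H_(k,k+1) = s - e\<close> survives; with
  \<open>e s = e\<close> and \<open>e e = \<delta> e\<close> it leaves the factor
  \<open>1 - \<delta>\<close>.\<close>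

lemma e_el_Theta_el_adjacent:
  fixes \<delta> :: "'k::comm_ring_1"
  assumes "Suc k < r"
  defines "e \<equiv> e_el \<delta> r k (Suc k)"
  shows "e * (Theta_el \<delta> r k + Theta_el \<delta> r (Suc k)) = el \<delta> r (Scl (1 - \<delta>) (iota (ed r k (Suc k))))"
    and "(Theta_el \<delta> r k + Theta_el \<delta> r (Suc k)) * e = el \<delta> r (Scl (1 - \<delta>) (iota (ed r k (Suc k))))"
proof -
  have Th: "Theta_el \<delta> r k + Theta_el \<delta> r (Suc k) = (h_el \<delta> r k + h_el \<delta> r (Suc k))
      + (\<Sum>a<k. H_el \<delta> r a k + H_el \<delta> r a (Suc k)) + (perm_el \<delta> r (tr k (Suc k)) - e)"
    by (simp add: Theta_el_def H_el_def[of \<delta> r k "Suc k"] e_def sum.distrib add_ac)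
  have h0: "e * (h_el \<delta> r k + h_el \<delta> r (Suc k)) = 0" "(h_el \<delta> r k + h_el \<delta> r (Suc k)) * e = 0"
    unfolding e_def using assms by (intro e_el_h_el_sum; simp)+
  have "e * (H_el \<delta> r a k + H_el \<delta> r a (Suc k)) = 0 \<and> (H_el \<delta> r a k + H_el \<delta> r a (Suc k)) * e = 0" if "a < k" for a
    unfolding e_def H_el_commute[of \<delta> r a] using assms that by (intro conjI e_el_H_el_sum) auto
  then have s0: "e * (\<Sum>a<k. H_el \<delta> r a k + H_el \<delta> r a (Suc k)) = 0" "(\<Sum>a<k. H_el \<delta> r a k + H_el \<delta> r a (Suc k)) * e = 0"
    by (simp_all only: sum_distrib_left sum_distrib_right) simp_all
  have "e * perm_el \<delta> r (tr k (Suc k)) = e" "perm_el \<delta> r (tr k (Suc k)) * e = e"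
    unfolding e_def using assms by (simp_all add: perm_el_tr_e_el)
  moreover have "el \<delta> r (Scl (1 - \<delta>) (iota (ed r k (Suc k)))) = e - e * e"
    unfolding e_def using assms by (subst el_Scl_one_minus) (auto simp: e_el_self e_el_def[symmetric])
  ultimately show "e * (Theta_el \<delta> r k + Theta_el \<delta> r (Suc k)) = el \<delta> r (Scl (1 - \<delta>) (iota (ed r k (Suc k))))"
    "(Theta_el \<delta> r k + Theta_el \<delta> r (Suc k)) * e = el \<delta> r (Scl (1 - \<delta>) (iota (ed r k (Suc k))))"
    unfolding Th by (simp_all only: distrib_left[of e] distrib_right[of _ _ e] h0[unfolded distrib_left[of e] distrib_right[of _ _ e]]
        s0 right_diff_distrib left_diff_distrib add_0_left add_0_right)
qed

section \<open>Powers of \<open>\<Theta>_1\<close> between two arcs\<close>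

lemma tpow_wt [simp]: "wt t \<Longrightarrow> tdom t = n \<Longrightarrow> tcod t = n \<Longrightarrow> endo n (tpow n t l)"
  by (induction l) auto

lemma Theta_one: "r \<ge> 1 \<Longrightarrow> abeq \<delta> (Theta r 1) (Tns PoleH (idd (r - 1)))"
  using el_Theta[of 0 r \<delta>] h_el_0[of r \<delta>] endo_Theta[of 0 r]
  by (simp add: Theta_el_def pole_el_def flip: el_eq_iff[where r = r])

lemma tpow_Theta_one:
  assumes "r \<ge> 1"
  shows "abeq \<delta> (tpow r (Theta r 1) l) (Tns (tpow 1 PoleH l) (idd (r - 1)))"
proof (induction l)
  case 0
  have "abeq \<delta> (Tns (IIr 1) (idd (r - 1))) (iota (dtens (idd 1) (idd (r - 1))))"
    unfolding IIr_def by (rule Tns_iota) auto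
  then show ?case using assms by (auto simp: IIr_def intro: abeq.sym)
next
  case (Suc l)
  have e: "endo 1 (tpow 1 PoleH l :: 'a abt)" "endo r (tpow r (Theta r 1 :: 'a abt) l)" "endo r (Theta r 1 :: 'a abt)"
    using endo_Theta[of 0 r] assms by auto
  have "abeq \<delta> (tpow r (Theta r 1) (Suc l)) (Cmp (Tns PoleH (idd (r - 1))) (Tns (tpow 1 PoleH l) (idd (r - 1))))"
    using Suc.IH e Theta_one[OF assms, of \<delta>] by (auto intro!: abeq.cong_cmp)
  also have "abeq \<delta> \<dots> (Tns (tpow 1 PoleH (Suc l)) (idd (r - 1)))"
    using e abeq.sym[OF Tns_Cmp[of PoleH "tpow 1 PoleH l" \<delta> "r - 1"]] by simp
  finally show ?case .
qed

text \<open>With \<open>z\<close> written as \<open>Tns z (idd 0)\<close>, the interchange law turns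
  both composites into \<open>Tns z cupd\<close>. The preliminary facts are needed because
  \<open>PoleI\<close> and \<open>IIr 0\<close> are different terms for the identity of
  \<open>0\<close>.\<close>

lemma scalar_cup:
  fixes \<delta> :: "'k::comm_ring_1"
  assumes "endo 0 (z :: 'k abt)"
  shows "abeq \<delta> (Cmp (iota cupd) z) (Cmp (Tns z (idd 2)) (iota cupd))"
proof -
  have PI: "abeq \<delta> (IIr 0 :: 'k abt) PoleI"
    unfolding IIr_def iota_def by (rule abeq.tns_unit) auto
  have l: "abeq \<delta> (Cmp PoleI z) z"
    using abeq.trans[OF cmpL[OF abeq.sym[OF PI], of z] abeq.id_left[of z \<delta>, simplified assms[THEN conjunct2, THEN conjunct2]]]
      assms by auto
  have rr: "abeq \<delta> (Cmp z PoleI) z"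
    using abeq.trans[OF cmpR[OF abeq.sym[OF PI], of z] abeq.id_right[of z \<delta>, simplified assms[THEN conjunct2, THEN conjunct1]]]
      assms by auto
  have "abeq \<delta> (Cmp (iota cupd) z) (Cmp (iota cupd) (Tns z (idd 0)))"
    using assms by (intro cmpR abeq.sym[OF abeq.tns_unit]) auto
  also have "abeq \<delta> \<dots> (Tns (Cmp PoleI z) cupd)"
    unfolding iota_def
  proof (rule abeq_Scl_loops0)
    show "abeq \<delta> (Cmp (Tns PoleI cupd) (Tns z (idd 0))) (Scl (\<delta> ^ loops cupd (idd 0)) (Tns (Cmp PoleI z) cupd))"
      using abeq.interchange[of PoleI z cupd "idd 0" \<delta>] assms dcomp_idd_right[OF valid_cupd] by simp
  qed (use assms loops_idd_right[OF valid_cupd] in auto)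
  also have "abeq \<delta> \<dots> (Tns z cupd)" by (intro abeq.cong_tns l) auto
  also have "abeq \<delta> \<dots> (Tns (Cmp z PoleI) cupd)" by (intro abeq.cong_tns abeq.sym[OF rr]) auto
  also have "abeq \<delta> \<dots> (Cmp (Tns z (idd 2)) (iota cupd))"
    unfolding iota_def
  proof (rule abeq.sym, rule abeq_Scl_loops0)
    show "abeq \<delta> (Cmp (Tns z (idd 2)) (Tns PoleI cupd)) (Scl (\<delta> ^ loops (idd 2) cupd) (Tns (Cmp z PoleI) cupd))"
      using abeq.interchange[of z PoleI "idd 2" cupd \<delta>] assms dcomp_idd_left[OF valid_cupd] by simp
  qed (use assms loops_idd_left[OF valid_cupd] in auto)
  finally show ?thesis .
qed

text \<open>Reassociation isolates cap, \<open>g\<close>, cup as an endomorphism of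
  \<open>0\<close>, which \<open>scalar_cup\<close> carries past the outer cup.\<close>

lemma cup_cap_sandwich:
  fixes \<delta> :: "'k::comm_ring_1"
  assumes "endo 2 (g :: 'k abt)"
  defines "u \<equiv> iota cupd :: 'k abt" and "c \<equiv> iota capd :: 'k abt"
  shows "abeq \<delta> (Cmp (Cmp u c) (Cmp g (Cmp u c))) (Cmp (Tns (Cmp c (Cmp g u)) (idd 2)) (Cmp u c))"
proof -
  have uc: "wt u" "tdom u = 0" "tcod u = 2" "wt c" "tdom c = 2" "tcod c = 0" by (auto simp: u_def c_def)
  let ?z = "Cmp c (Cmp g u)"
  have "abeq \<delta> (Cmp c (Cmp g (Cmp u c))) (Cmp c (Cmp (Cmp g u) c))"
    using assms(1) uc by (intro cmpR abeq.sym[OF abeq.cmp_assoc]) auto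
  also have "abeq \<delta> \<dots> (Cmp ?z c)"
    using assms(1) uc by (intro abeq.sym[OF abeq.cmp_assoc]) auto
  finally have z: "abeq \<delta> (Cmp c (Cmp g (Cmp u c))) (Cmp ?z c)" .
  have "abeq \<delta> (Cmp (Cmp u c) (Cmp g (Cmp u c))) (Cmp u (Cmp c (Cmp g (Cmp u c))))"
    using assms(1) uc by (intro abeq.cmp_assoc) auto
  also have "abeq \<delta> \<dots> (Cmp u (Cmp ?z c))" using assms(1) uc by (intro cmpR z) auto
  also have "abeq \<delta> \<dots> (Cmp (Cmp u ?z) c)" using assms(1) uc by (intro abeq.sym[OF abeq.cmp_assoc]) auto
  also have "abeq \<delta> \<dots> (Cmp (Cmp (Tns ?z (idd 2)) u) c)"
    using assms(1) uc scalar_cup[of ?z \<delta>] by (intro cmpL) (auto simp: u_def)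
  also have "abeq \<delta> \<dots> (Cmp (Tns ?z (idd 2)) (Cmp u c))" using assms(1) uc by (intro abeq.cmp_assoc) auto
  finally show ?thesis .
qed

text \<open>All factors are two-strand morphisms tensored with \<open>m\<close> identity strands, so
  the sandwich is computed on two strands and tensored afterwards.\<close>

lemma e_Theta_e:
  fixes \<delta> :: "'k::comm_ring_1"
  assumes "r \<ge> 2"
  shows "abeq \<delta> (Cmp (iota (ekd r 1)) (Cmp (tpow r (Theta r 1) l) (iota (ekd r 1))))
                (Cmp (Tns (Zl l) (idd r)) (iota (ekd r 1)))"
proof -
  obtain m where r: "r = m + 2" using assms by (metis add.commute le_iff_add)
  let ?p = "tpow 1 PoleH l :: 'k abt"
  \<comment> \<open>For this \<open>g\<close>, cap after \<open>g\<close> after cup is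
    \<open>Z_l\<close>, while \<open>g\<close> with \<open>m\<close> further strands is the power of
    \<open>\<Theta>_1\<close>.\<close>
  define g where "g = Tns ?p (idd 1)"
  have p: "endo 1 ?p" by simp
  then have g: "endo 2 g" by (auto simp: g_def)
  let ?uc = "Cmp (iota cupd) (iota capd) :: 'k abt"
  have ekd: "ekd r 1 = ed (m + 2) 0 1" by (simp add: ekd_def ed_def r)
  have Zl: "(Zl l :: 'k abt) = Cmp (iota capd) (Cmp g (iota cupd))" by (simp add: Zl_def g_def)
  have e: "abeq \<delta> (iota (ekd r 1)) (Tns ?uc (idd m))"
  proof -
    have "abeq \<delta> (Tns ?uc (idd m)) (Tns (iota (ed 2 0 1)) (idd m))"
      by (intro abeq.cong_tns cup_cap) auto
    also have "abeq \<delta> \<dots> (iota (dtens (ed 2 0 1) (idd m)))" by (intro Tns_iota) auto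
    finally show ?thesis unfolding dtens_ed_idd ekd by (rule abeq.sym)
  qed
  have w: "abeq \<delta> (tpow r (Theta r 1) l) (Tns g (idd m))"
  proof -
    have "abeq \<delta> (tpow r (Theta r 1) l) (Tns ?p (idd (r - 1)))" using assms by (intro tpow_Theta_one) auto
    also have "idd (r - 1) = dtens (idd 1) (idd m)" by (simp add: r)
    also have "abeq \<delta> (Tns ?p (dtens (idd 1) (idd m))) (Tns g (idd m))"
      unfolding g_def using p by (intro abeq.sym[OF abeq.tns_tns]) auto
    finally show ?thesis .
  qed
  have z: "abeq \<delta> (Tns (Tns (Zl l) (idd 2)) (idd m)) (Tns (Zl l) (idd r))"
  proof -
    have "abeq \<delta> (Tns (Tns (Zl l) (idd 2)) (idd m)) (Tns (Zl l) (dtens (idd 2) (idd m)))"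
      using g unfolding Zl by (intro abeq.tns_tns) auto
    then show ?thesis by (simp add: r add.commute)
  qed
  have en: "endo r (tpow r (Theta r 1) l :: 'k abt)" "endo r (iota (ekd r 1) :: 'k abt)"
    unfolding ekd using endo_Theta[of 0 r] assms by (auto simp: r)
  have "abeq \<delta> (Cmp (iota (ekd r 1)) (Cmp (tpow r (Theta r 1) l) (iota (ekd r 1))))
      (Cmp (Tns ?uc (idd m)) (Cmp (Tns g (idd m)) (Tns ?uc (idd m))))"
    using en by (intro abeq.cong_cmp e w) auto
  also have "abeq \<delta> \<dots> (Cmp (Tns ?uc (idd m)) (Tns (Cmp g ?uc) (idd m)))"
    using g by (intro cmpR abeq.sym[OF Tns_Cmp]) auto
  also have "abeq \<delta> \<dots> (Tns (Cmp ?uc (Cmp g ?uc)) (idd m))"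
    using g by (intro abeq.sym[OF Tns_Cmp]) auto
  also have "abeq \<delta> \<dots> (Tns (Cmp (Tns (Zl l) (idd 2)) ?uc) (idd m))"
    unfolding Zl using g by (intro abeq.cong_tns cup_cap_sandwich) auto
  also have "abeq \<delta> \<dots> (Cmp (Tns (Tns (Zl l) (idd 2)) (idd m)) (Tns ?uc (idd m)))"
    unfolding Zl using g by (intro Tns_Cmp) auto
  also have "abeq \<delta> \<dots> (Cmp (Tns (Zl l) (idd r)) (iota (ekd r 1)))"
    using g by (intro abeq.cong_cmp z abeq.sym[OF e]) (auto simp: Zl)
  finally show ?thesis .
qed

theorem theorem3p7:
  fixes \<delta> :: "'k::comm_ring_1" and r :: nat
  assumes "r \<ge> 1"
  shows
   "(\<forall>l\<ge>1. r \<ge> 2 \<longrightarrow>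
        abeq \<delta> (Cmp (iota (ekd r 1)) (Cmp (tpow r (Theta r 1) l) (iota (ekd r 1))))
                (Cmp (Tns (Zl l) (idd r)) (iota (ekd r 1))))
  \<and> (\<forall>i j. 1 \<le> i \<and> i \<le> r \<and> 1 \<le> j \<and> j \<le> r \<longrightarrow>
        abeq \<delta> (Cmp (Theta r i) (Theta r j)) (Cmp (Theta r j) (Theta r i)))
  \<and> (\<forall>k j. 1 \<le> k \<and> k < r \<and> 1 \<le> j \<and> j \<le> r \<and> j \<noteq> k \<and> j \<noteq> k + 1 \<longrightarrow>
        abeq \<delta> (Cmp (iota (skd r k)) (Theta r j)) (Cmp (Theta r j) (iota (skd r k)))
      \<and> abeq \<delta> (Cmp (iota (ekd r k)) (Theta r j)) (Cmp (Theta r j) (iota (ekd r k))))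
  \<and> (\<forall>k. 1 \<le> k \<and> k < r \<longrightarrow>
        abeq \<delta> (tminus (Cmp (iota (skd r k)) (Theta r k)) (Cmp (Theta r (k + 1)) (iota (skd r k))))
                (tminus (iota (ekd r k)) (IIr r))
      \<and> abeq \<delta> (tminus (Cmp (Theta r k) (iota (skd r k))) (Cmp (iota (skd r k)) (Theta r (k + 1))))
                (tminus (iota (ekd r k)) (IIr r)))
  \<and> (\<forall>k. 1 \<le> k \<and> k < r \<longrightarrow>
        abeq \<delta> (Cmp (iota (ekd r k)) (Pls (Theta r k) (Theta r (k + 1))))
                (Scl (1 - \<delta>) (iota (ekd r k)))
      \<and> abeq \<delta> (Cmp (Pls (Theta r k) (Theta r (k + 1))) (iota (ekd r k)))
                (Scl (1 - \<delta>) (iota (ekd r k))))"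
proof (intro conjI allI impI; (elim conjE)?)
  fix l :: nat assume "r \<ge> 2"
  then show "abeq \<delta> (Cmp (iota (ekd r 1)) (Cmp (tpow r (Theta r 1) l) (iota (ekd r 1))))
                (Cmp (Tns (Zl l) (idd r)) (iota (ekd r 1)))" by (rule e_Theta_e)
next
  fix i j assume ij: "1 \<le> i" "i \<le> r" "1 \<le> j" "j \<le> r"
  \<comment> \<open>Positions in the statement count from 1, those of the ring elements from
    0.\<close>
  then obtain i' j' where "i = Suc i'" "j = Suc j'" by (metis Suc_le_D One_nat_def)
  with ij show "abeq \<delta> (Cmp (Theta r i) (Theta r j)) (Cmp (Theta r j) (Theta r i))"
    by (subst el_eq_iff[where r = r, symmetric]) (auto simp: el_Cmp el_Theta Theta_el_commute)
next
  fix k j assume kj: "1 \<le> k" "k < r" "1 \<le> j" "j \<le> r" "j \<noteq> k" "j \<noteq> k + 1"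
  then obtain k' j' where kj': "k = Suc k'" "j = Suc j'" by (metis Suc_le_D One_nat_def)
  show "abeq \<delta> (Cmp (iota (skd r k)) (Theta r j)) (Cmp (Theta r j) (iota (skd r k)))"
    using kj cross_Theta_el[of k' r j' \<delta>] unfolding kj'
    by (subst el_eq_iff[where r = r, symmetric]) (auto simp: el_Cmp el_Theta skd_def transpd_def pbij_tr perm_el_def)
  show "abeq \<delta> (Cmp (iota (ekd r k)) (Theta r j)) (Cmp (Theta r j) (iota (ekd r k)))"
    using kj e_el_Theta_el[of k' r j' \<delta>] unfolding kj'
    by (subst el_eq_iff[where r = r, symmetric]) (auto simp: el_Cmp el_Theta ekd_def e_el_def simp flip: ed_def)
next
  fix k assume k: "1 \<le> k" "k < r"
  then obtain k' where k': "k = Suc k'" "Suc k' < r" by (metis Suc_le_D One_nat_def)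
  have ids: "skd r k = permd r (tr k' (Suc k'))" "ekd r k = ed r k' (Suc k')" "IIr r = iota (permd r id)"
    by (simp_all add: k' skd_def transpd_def ekd_def ed_def IIr_def idd_permd)
  note simps = k'(1) el_Cmp el_Pls el_tminus el_Theta pbij_tr pbij_id perm_el_def[symmetric] e_el_def[symmetric]
  show "abeq \<delta> (tminus (Cmp (iota (skd r k)) (Theta r k)) (Cmp (Theta r (k + 1)) (iota (skd r k))))
                (tminus (iota (ekd r k)) (IIr r))"
    unfolding ids using k' cross_Theta_el_adjacent(1)[OF k'(2), of \<delta>]
    by (subst el_eq_iff[where r = r, symmetric]) (auto simp: simps)
  show "abeq \<delta> (tminus (Cmp (Theta r k) (iota (skd r k))) (Cmp (iota (skd r k)) (Theta r (k + 1))))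
                (tminus (iota (ekd r k)) (IIr r))"
    unfolding ids using k' cross_Theta_el_adjacent(2)[OF k'(2), of \<delta>]
    by (subst el_eq_iff[where r = r, symmetric]) (auto simp: simps)
  show "abeq \<delta> (Cmp (iota (ekd r k)) (Pls (Theta r k) (Theta r (k + 1)))) (Scl (1 - \<delta>) (iota (ekd r k)))"
    unfolding ids using k' e_el_Theta_el_adjacent(1)[OF k'(2), of \<delta>]
    by (subst el_eq_iff[where r = r, symmetric]) (auto simp: simps)
  show "abeq \<delta> (Cmp (Pls (Theta r k) (Theta r (k + 1))) (iota (ekd r k))) (Scl (1 - \<delta>) (iota (ekd r k)))"
    unfolding ids using k' e_el_Theta_el_adjacent(2)[OF k'(2), of \<delta>]
    by (subst el_eq_iff[where r = r, symmetric]) (auto simp: simps)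
qed

end
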